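(* Let $(\mathbf{M}^n,g)$ be a complete Riemannian manifold and $V$ a $C^1$ vector field. Let $N$ be a natural number, $p_1<\dots<p_N\le1$ real numbers and $a_1,\dots,a_N\ge0$. Let $u$ be a smooth positive solution of $\partial_tu=\Delta_Vu+\sum_{i=1}^Na_iu^{p_i}$ on $\mathbf{M}^n\times(0,\infty)$, put $f:=\ln u$, and suppose that for some $C^1$ functions $\gamma>0$, $\alpha>0$ and $\varphi$ of $t\in(0,\infty)$ the global differential Harnack inequality $$\gamma\frac{|\nabla u|^2}{u^2}-\alpha\frac{u_t}{u}+\alpha\sum_{i=1}^Na_iu^{p_i-1}-\varphi\le0\qquad\text{on }\mathbf{M}^n\times(0,\infty)$$ holds. Let $x_1,x_2\in\mathbf{M}^n$ and $0<t_1<t_2$. Then $$f(x_2,t_2)-f(x_1,t_1)\ge\int_{t_1}^{t_2}\left(\frac{-\varphi}{\alpha}-\frac{\alpha}{4\gamma}\left|\frac{dl}{dt}\right|^2\right)dt$$ for every smooth path $l:[t_1,t_2]\to\mathbf{M}^n$ with $l(t_1)=x_1$, $l(t_2)=x_2$. Moreover, if $\alpha$ and $\gamma$ are positive constants, then (taking $l$ a minimizing geodesic with constant speed) $$f(x_2,t_2)-f(x_1,t_1)\ge-\int_{t_1}^{t_2}\frac{\varphi}{\alpha}\,dt-\frac{\alpha}{4\gamma}\cdot\frac{d(x_1,x_2)^2}{t_2-t_1}.$$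
   Context: Notation: $\Delta_V u:=\Delta u+\langle V,\nabla u\rangle$; $d$ is the Riemannian distance. *)

theory Defs
  imports "HOL-Analysis.Analysis"
begin

section \<open>Differentiability classes on open sets\<close>

text \<open>Iterated directional derivatives; meant for open \<open>S\<close>, where it is the usual notion of
  \<open>C\<^sup>k\<close> for maps between finite-dimensional spaces.\<close>

primrec Ck_on ::
  "nat \<Rightarrow> 'e::real_normed_vector set \<Rightarrow> ('e \<Rightarrow> 'f::real_normed_vector) \<Rightarrow> bool" where
  "Ck_on 0 S f \<longleftrightarrow> continuous_on S f"
| "Ck_on (Suc k) S f \<longleftrightarrow>
     (\<forall>x\<in>S. f differentiable (at x)) \<and>
     (\<forall>v. Ck_on k S (\<lambda>x. frechet_derivative f (at x) v))"

definition smooth_on :: "'e::real_normed_vector set \<Rightarrow> ('e \<Rightarrow> 'f::real_normed_vector) \<Rightarrow> bool" where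
  "smooth_on S f \<longleftrightarrow> (\<forall>k. Ck_on k S f)"


section \<open>Smooth manifolds\<close>

text \<open>A chart is a pair of its domain and its coordinate map. A manifold is an abstract topology
  together with a (not necessarily maximal) smooth atlas; its dimension is \<open>CARD('n)\<close>.\<close>

type_synonym ('a, 'n) chart = "'a set \<times> ('a \<Rightarrow> real ^ 'n)"

definition chart_inv :: "('a, 'n::finite) chart \<Rightarrow> real ^ 'n \<Rightarrow> 'a" where
  "chart_inv c = inv_into (fst c) (snd c)"

definition transition ::
  "('a, 'n::finite) chart \<Rightarrow> ('a, 'n) chart \<Rightarrow> real ^ 'n \<Rightarrow> real ^ 'n" where
  "transition c c' = snd c' \<circ> chart_inv c"

definition is_chart :: "'a topology \<Rightarrow> ('a, 'n::finite) chart \<Rightarrow> bool" where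
  "is_chart X c \<longleftrightarrow>
     openin X (fst c) \<and> open (snd c ` fst c) \<and>
     homeomorphic_map (subtopology X (fst c)) (top_of_set (snd c ` fst c)) (snd c)"

definition smooth_atlas :: "'a topology \<Rightarrow> ('a, 'n::finite) chart set \<Rightarrow> bool" where
  "smooth_atlas X A \<longleftrightarrow>
     (\<forall>c\<in>A. is_chart X c) \<and> (\<Union>c\<in>A. fst c) = topspace X \<and>
     (\<forall>c\<in>A. \<forall>c'\<in>A. smooth_on (snd c ` (fst c \<inter> fst c')) (transition c c'))"

definition second_countable_space :: "'a topology \<Rightarrow> bool" where
  "second_countable_space X \<longleftrightarrow>
     (\<exists>B. countable B \<and> (\<forall>W\<in>B. openin X W) \<and>
          (\<forall>U x. openin X U \<and> x \<in> U \<longrightarrow> (\<exists>W\<in>B. x \<in> W \<and> W \<subseteq> U)))"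

definition smooth_manifold :: "'a topology \<Rightarrow> ('a, 'n::finite) chart set \<Rightarrow> bool" where
  "smooth_manifold X A \<longleftrightarrow>
     Hausdorff_space X \<and> second_countable_space X \<and> smooth_atlas X A"

definition charts_at :: "('a, 'n::finite) chart set \<Rightarrow> 'a \<Rightarrow> ('a, 'n) chart set" where
  "charts_at A p = {c \<in> A. p \<in> fst c}"

definition chart_at :: "('a, 'n::finite) chart set \<Rightarrow> 'a \<Rightarrow> ('a, 'n) chart" where
  "chart_at A p = (SOME c. c \<in> charts_at A p)"


section \<open>Tangent vectors and vector fields\<close>

text \<open>A tangent vector at \<open>p\<close> assigns to every chart around \<open>p\<close> its component vector, and the
  components are related by the Jacobians of the coordinate changes. The value \<open>0\<close> on
  all other arguments makes the representation unique.\<close>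

type_synonym ('a, 'n) tangent = "('a, 'n) chart \<Rightarrow> real ^ 'n"

definition tangent_space ::
  "('a, 'n::finite) chart set \<Rightarrow> 'a \<Rightarrow> ('a, 'n) tangent set" where
  "tangent_space A p =
     {\<xi>. (\<forall>c\<in>charts_at A p. \<forall>c'\<in>charts_at A p.
            \<xi> c' = frechet_derivative (transition c c') (at (snd c p)) (\<xi> c)) \<and>
         (\<forall>c. c \<notin> charts_at A p \<longrightarrow> \<xi> c = 0)}"

text \<open>The tangent vector at \<open>p\<close> whose components in the chart \<open>c\<close> are \<open>v\<close>; for \<open>v = axis i 1\<close>
  this is the \<open>i\<close>-th coordinate vector.\<close>

definition tangent_of ::
  "('a, 'n::finite) chart set \<Rightarrow> ('a, 'n) chart \<Rightarrow> 'a \<Rightarrow> real ^ 'n \<Rightarrow> ('a, 'n) tangent" where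
  "tangent_of A c p v =
     (\<lambda>c'. if c' \<in> charts_at A p
           then frechet_derivative (transition c c') (at (snd c p)) v else 0)"

definition C1_vector_field ::
  "'a topology \<Rightarrow> ('a, 'n::finite) chart set \<Rightarrow> ('a \<Rightarrow> ('a, 'n) tangent) \<Rightarrow> bool" where
  "C1_vector_field X A V \<longleftrightarrow>
     (\<forall>p\<in>topspace X. V p \<in> tangent_space A p) \<and>
     (\<forall>c\<in>A. Ck_on 1 (snd c ` fst c) (\<lambda>y. V (chart_inv c y) c))"

definition differential ::
  "('a, 'n::finite) chart set \<Rightarrow> ('a \<Rightarrow> real) \<Rightarrow> 'a \<Rightarrow> ('a, 'n) tangent \<Rightarrow> real" where
  "differential A u p \<xi> =
     (let c = chart_at A p
      in frechet_derivative (u \<circ> chart_inv c) (at (snd c p)) (\<xi> c))"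


section \<open>Riemannian metrics and differential operators\<close>

type_synonym ('a, 'n) metric_tensor = "'a \<Rightarrow> ('a, 'n) tangent \<Rightarrow> ('a, 'n) tangent \<Rightarrow> real"

definition metric_matrix ::
  "('a, 'n::finite) chart set \<Rightarrow> ('a, 'n) metric_tensor \<Rightarrow> ('a, 'n) chart \<Rightarrow>
   real ^ 'n \<Rightarrow> real ^ 'n ^ 'n" where
  "metric_matrix A g c y =
     (let p = chart_inv c y
      in \<chi> i j. g p (tangent_of A c p (axis i 1)) (tangent_of A c p (axis j 1)))"

definition riemannian_metric ::
  "'a topology \<Rightarrow> ('a, 'n::finite) chart set \<Rightarrow> ('a, 'n) metric_tensor \<Rightarrow> bool" where
  "riemannian_metric X A g \<longleftrightarrow>
     (\<forall>p\<in>topspace X.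
        (\<forall>\<xi>\<in>tangent_space A p. \<forall>\<eta>\<in>tangent_space A p. g p \<xi> \<eta> = g p \<eta> \<xi>) \<and>
        (\<forall>\<xi>\<in>tangent_space A p. \<forall>\<eta>\<in>tangent_space A p. \<forall>\<zeta>\<in>tangent_space A p. \<forall>r s.
           g p (\<lambda>c. r *\<^sub>R \<xi> c + s *\<^sub>R \<eta> c) \<zeta> = r * g p \<xi> \<zeta> + s * g p \<eta> \<zeta>) \<and>
        (\<forall>\<xi>\<in>tangent_space A p. \<xi> \<noteq> (\<lambda>_. 0) \<longrightarrow> g p \<xi> \<xi> > 0)) \<and>
     (\<forall>c\<in>A. \<forall>i j. smooth_on (snd c ` fst c) (\<lambda>y. metric_matrix A g c y $ i $ j))"

definition tangent_norm ::
  "('a, 'n::finite) metric_tensor \<Rightarrow> 'a \<Rightarrow> ('a, 'n) tangent \<Rightarrow> real" where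
  "tangent_norm g p \<xi> = sqrt (g p \<xi> \<xi>)"

definition gradient ::
  "('a, 'n::finite) chart set \<Rightarrow> ('a, 'n) metric_tensor \<Rightarrow> ('a \<Rightarrow> real) \<Rightarrow> 'a \<Rightarrow>
   ('a, 'n) tangent" where
  "gradient A g u p =
     (THE \<xi>. \<xi> \<in> tangent_space A p \<and>
            (\<forall>\<eta>\<in>tangent_space A p. g p \<xi> \<eta> = differential A u p \<eta>))"

text \<open>The coordinate expression \<open>(det g)\<^sup>-\<^sup>1\<^sup>/\<^sup>2 \<partial>\<^sub>i ((det g)\<^sup>1\<^sup>/\<^sup>2 Y\<^sup>i)\<close>
  of the divergence does not depend on the chart.\<close>

definition divergence ::
  "('a, 'n::finite) chart set \<Rightarrow> ('a, 'n) metric_tensor \<Rightarrow> ('a \<Rightarrow> ('a, 'n) tangent) \<Rightarrow>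
   'a \<Rightarrow> real" where
  "divergence A g Y p =
     (let c = chart_at A p; y = snd c p; w = (\<lambda>z. sqrt (det (metric_matrix A g c z)))
      in (\<Sum>i\<in>UNIV. frechet_derivative (\<lambda>z. w z * Y (chart_inv c z) c $ i) (at y) (axis i 1))
         / w y)"

definition laplacian ::
  "('a, 'n::finite) chart set \<Rightarrow> ('a, 'n) metric_tensor \<Rightarrow> ('a \<Rightarrow> real) \<Rightarrow> 'a \<Rightarrow> real" where
  "laplacian A g u = divergence A g (gradient A g u)"

definition drift_laplacian ::
  "('a, 'n::finite) chart set \<Rightarrow> ('a, 'n) metric_tensor \<Rightarrow> ('a \<Rightarrow> ('a, 'n) tangent) \<Rightarrow>
   ('a \<Rightarrow> real) \<Rightarrow> 'a \<Rightarrow> real" where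
  "drift_laplacian A g V u p = laplacian A g u p + g p (V p) (gradient A g u p)"

definition smooth_spacetime ::
  "('a, 'n::finite) chart set \<Rightarrow> ('a \<Rightarrow> real \<Rightarrow> real) \<Rightarrow> bool" where
  "smooth_spacetime A u \<longleftrightarrow>
     (\<forall>c\<in>A. smooth_on ((snd c ` fst c) \<times> {0<..}) (\<lambda>z. u (chart_inv c (fst z)) (snd z)))"


section \<open>Paths, Riemannian distance and completeness\<close>

text \<open>As usual, smoothness on a compact interval means that there is a smooth extension to an open
  neighbourhood.\<close>

definition smooth_path ::
  "'a topology \<Rightarrow> ('a, 'n::finite) chart set \<Rightarrow> real \<Rightarrow> real \<Rightarrow> (real \<Rightarrow> 'a) \<Rightarrow> bool" where
  "smooth_path X A a b l \<longleftrightarrow>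
     (\<exists>e>0. \<exists>m. continuous_map (top_of_set {a - e<..<b + e}) X m \<and>
        (\<forall>t\<in>{a..b}. m t = l t) \<and>
        (\<forall>c\<in>A. smooth_on ({a - e<..<b + e} \<inter> m -` fst c) (snd c \<circ> m)))"

definition piecewise_smooth_path ::
  "'a topology \<Rightarrow> ('a, 'n::finite) chart set \<Rightarrow> real \<Rightarrow> real \<Rightarrow> (real \<Rightarrow> 'a) \<Rightarrow> bool" where
  "piecewise_smooth_path X A a b l \<longleftrightarrow>
     continuous_map (top_of_set {a..b}) X l \<and>
     (\<exists>P. finite P \<and> {a, b} \<subseteq> P \<and> P \<subseteq> {a..b} \<and>
        (\<forall>r\<in>P. \<forall>s\<in>P. r < s \<and> {r<..<s} \<inter> P = {} \<longrightarrow> smooth_path X A r s l))"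

text \<open>The velocity of \<open>l\<close> on \<open>{a..b}\<close>, one-sided at the end points.\<close>

definition velocity ::
  "('a, 'n::finite) chart set \<Rightarrow> real \<Rightarrow> real \<Rightarrow> (real \<Rightarrow> 'a) \<Rightarrow> real \<Rightarrow> ('a, 'n) tangent" where
  "velocity A a b l t =
     (\<lambda>c. if c \<in> charts_at A (l t)
          then vector_derivative (snd c \<circ> l) (at t within {a..b}) else 0)"

definition curve_length ::
  "('a, 'n::finite) chart set \<Rightarrow> ('a, 'n) metric_tensor \<Rightarrow> real \<Rightarrow> real \<Rightarrow> (real \<Rightarrow> 'a) \<Rightarrow> real"
  where
  "curve_length A g a b l = integral {a..b} (\<lambda>t. tangent_norm g (l t) (velocity A a b l t))"

definition riemannian_dist ::
  "'a topology \<Rightarrow> ('a, 'n::finite) chart set \<Rightarrow> ('a, 'n) metric_tensor \<Rightarrow> 'a \<Rightarrow> 'a \<Rightarrow> real" where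
  "riemannian_dist X A g x y =
     Inf {curve_length A g 0 1 l | l. piecewise_smooth_path X A 0 1 l \<and> l 0 = x \<and> l 1 = y}"

text \<open>Manifolds are connected, so that the infimum in the distance is over a nonempty set.\<close>

definition complete_riemannian_manifold ::
  "'a topology \<Rightarrow> ('a, 'n::finite) chart set \<Rightarrow> ('a, 'n) metric_tensor \<Rightarrow> bool" where
  "complete_riemannian_manifold X A g \<longleftrightarrow>
     smooth_manifold X A \<and> connected_space X \<and> riemannian_metric X A g \<and>
     Metric_space.mcomplete (topspace X) (riemannian_dist X A g)"

end

theory Submission
  imports Defs
begin

text \<open>Along a path \<open>l\<close> run with a clock \<open>\<tau>\<close>, the derivative of \<open>ln u (l s) (\<tau> s)\<close> is
  \<open>\<langle>\<nabla>u, l'\<rangle> / u + \<tau>' u\<^sub>t / u\<close>. Bounding \<open>u\<^sub>t / u\<close> from below by the Harnack inequality and completing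
  the square in \<open>\<nabla>u\<close> gives the lower bound \<open>- \<tau>' \<phi> / \<alpha> - \<alpha> |l'|\<^sup>2 / (4 \<gamma> \<tau>')\<close>; the first claim is
  the integrated inequality for \<open>\<tau> s = s\<close>.

  For the second claim no minimizing geodesic is needed. Take a piecewise smooth path of length \<open>L\<close>
  close to the distance and a clock whose rate is proportional to \<open>|l'| + \<epsilon>\<close>. Then \<open>|l'|\<^sup>2 / \<tau>'\<close> is at
  most \<open>|l'| (L + \<epsilon>) / (t\<^sub>2 - t\<^sub>1)\<close>, whose integral is \<open>L (L + \<epsilon>) / (t\<^sub>2 - t\<^sub>1)\<close>, and it remains to
  let \<open>\<epsilon>\<close> tend to \<open>0\<close>. Such paths exist because the manifold is connected.\<close>

section \<open>Smooth maps\<close>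

text \<open>On an open set the two functions agree near each point, so their Frechet derivatives
  coincide there; the induction then passes to the directional derivatives.\<close>

lemma Ck_on_cong:
  assumes "open S" "\<And>x. x \<in> S \<Longrightarrow> f x = h x" "Ck_on k S f"
  shows "Ck_on k S h"
  using assms(2,3)
proof (induction k arbitrary: f h)
  case 0
  then show ?case by (metis Ck_on.simps(1) continuous_on_cong)
next
  case (Suc k)
  have D: "(h has_derivative frechet_derivative f (at x)) (at x)" if "x \<in> S" for x
  proof (rule has_derivative_transform_within_open[where s = S and f = f])
    show "(f has_derivative frechet_derivative f (at x)) (at x)"
      using Suc.prems(2) that by (simp add: frechet_derivative_works)
  qed (use assms(1) that Suc.prems(1) in auto)
  have eq: "frechet_derivative f (at x) = frechet_derivative h (at x)" if "x \<in> S" for x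
    using frechet_derivative_at[OF D[OF that]] .
  have "Ck_on k S (\<lambda>x. frechet_derivative h (at x) v)" for v
    by (rule Suc.IH[of "\<lambda>x. frechet_derivative f (at x) v"]) (use eq Suc.prems(2) in auto)
  then show ?case
    using D by (auto simp: differentiable_def)
qed

lemma Ck_on_subset: "Ck_on k S f \<Longrightarrow> T \<subseteq> S \<Longrightarrow> Ck_on k T f"
  by (induction k arbitrary: f) (auto intro: continuous_on_subset)

text \<open>The derivative of the composite in direction \<open>v\<close> is the derivative of
  \<open>f\<close> in the fixed direction \<open>v *\<^sub>R w\<close>, read along the same line.
  The induction hypothesis therefore applies directly, and a chain rule for affine lines
  suffices.\<close>

lemma Ck_on_compose_line:
  fixes y w :: "'e::real_normed_vector"
  assumes "open S" "open T" "\<And>t. t \<in> T \<Longrightarrow> y + t *\<^sub>R w \<in> S" "Ck_on k S f"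
  shows "Ck_on k T (\<lambda>t. f (y + t *\<^sub>R w))"
  using assms(4)
proof (induction k arbitrary: f)
  case 0
  then show ?case
    by (auto intro!: continuous_on_compose2[of S f] continuous_intros assms(3))
next
  case (Suc k)
  have D: "((\<lambda>t. f (y + t *\<^sub>R w)) has_derivative
      (\<lambda>v. frechet_derivative f (at (y + t *\<^sub>R w)) (v *\<^sub>R w))) (at t)" if "t \<in> T" for t
  proof -
    have 1: "((\<lambda>t. y + t *\<^sub>R w) has_derivative (\<lambda>v. v *\<^sub>R w)) (at t)"
      by (auto intro!: derivative_eq_intros)
    have 2: "(f has_derivative frechet_derivative f (at (y + t *\<^sub>R w))) (at (y + t *\<^sub>R w))"
      using Suc.prems assms(3)[OF that] by (simp add: frechet_derivative_works)
    show ?thesis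
      using diff_chain_at[OF 1 2] by (simp add: o_def)
  qed
  have "Ck_on k T (\<lambda>t. frechet_derivative (\<lambda>t. f (y + t *\<^sub>R w)) (at t) v)" for v
  proof (rule Ck_on_cong[OF assms(2)])
    show "Ck_on k T (\<lambda>t. (\<lambda>x. frechet_derivative f (at x) (v *\<^sub>R w)) (y + t *\<^sub>R w))"
      by (rule Suc.IH) (use Suc.prems in auto)
    show "frechet_derivative f (at (y + t *\<^sub>R w)) (v *\<^sub>R w)
      = frechet_derivative (\<lambda>t. f (y + t *\<^sub>R w)) (at t) v" if "t \<in> T" for t
      using fun_cong[OF frechet_derivative_at[OF D[OF that]], of v] by simp
  qed
  then show ?case
    using D by (auto simp: differentiable_def)
qed

lemma Ck_on_1_continuous: "Ck_on 1 S f \<Longrightarrow> continuous_on S f"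
  by (simp add: continuous_at_imp_continuous_on differentiable_imp_continuous_within)

lemma smooth_on_differentiable:
  "smooth_on S f \<Longrightarrow> x \<in> S \<Longrightarrow> f differentiable (at x)"
  unfolding smooth_on_def by (metis Ck_on.simps(2))

lemma smooth_on_continuous: "smooth_on S f \<Longrightarrow> continuous_on S f"
  using Ck_on.simps(1)[of S f] unfolding smooth_on_def by blast

lemma smooth_on_cong:
  "open S \<Longrightarrow> (\<And>x. x \<in> S \<Longrightarrow> f x = h x) \<Longrightarrow> smooth_on S f \<Longrightarrow> smooth_on S h"
  unfolding smooth_on_def using Ck_on_cong by blast

lemma smooth_on_subset: "smooth_on S f \<Longrightarrow> T \<subseteq> S \<Longrightarrow> smooth_on T f"
  unfolding smooth_on_def using Ck_on_subset by blast

lemma smooth_on_vector_derivative_continuous: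
  fixes h :: "real \<Rightarrow> 'e::real_normed_vector"
  assumes "smooth_on S h"
  shows "continuous_on S (\<lambda>t. vector_derivative h (at t))"
proof -
  have "Ck_on (Suc 0) S h"
    using assms unfolding smooth_on_def by blast
  then have "continuous_on S (\<lambda>t. frechet_derivative h (at t) 1)"
    and "\<forall>x\<in>S. h differentiable (at x)" by auto
  then show ?thesis
    by (subst continuous_on_cong[OF refl, of _ _ "\<lambda>t. frechet_derivative h (at t) 1"])
      (auto simp: frechet_derivative_eq_vector_derivative)
qed

lemma axis_expansion: "z = (\<Sum>i\<in>UNIV. z $ i *\<^sub>R axis i 1)" for z :: "real ^ 'n"
  using basis_expansion[of z] by (simp add: scalar_mult_eq_scaleR)

section \<open>Tangent spaces and gradients\<close>

locale riemannian =
  fixes X :: "'a topology" and A :: "('a, 'n::finite) chart set" and g :: "('a, 'n) metric_tensor"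
  assumes manifold: "smooth_manifold X A" and metric: "riemannian_metric X A g"
begin

section \<open>Charts and their inverses\<close>

lemma chart: "c \<in> A \<Longrightarrow> is_chart X c"
  using manifold by (simp add: smooth_manifold_def smooth_atlas_def)

lemma chart_open: "c \<in> A \<Longrightarrow> openin X (fst c)"
  using chart by (simp add: is_chart_def)

lemma chart_image_open: "c \<in> A \<Longrightarrow> open (snd c ` fst c)"
  using chart by (simp add: is_chart_def)

lemma chart_homeo:
  "c \<in> A \<Longrightarrow> homeomorphic_map (subtopology X (fst c)) (top_of_set (snd c ` fst c)) (snd c)"
  using chart by (simp add: is_chart_def)

lemma chart_inj: "c \<in> A \<Longrightarrow> inj_on (snd c) (fst c)"
  using homeomorphic_imp_injective_map[OF chart_homeo] openin_subset[OF chart_open]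
  by (simp add: Int_absorb1)

lemma chart_inv_left: "c \<in> A \<Longrightarrow> p \<in> fst c \<Longrightarrow> chart_inv c (snd c p) = p"
  by (simp add: chart_inv_def chart_inj)

lemma chart_inv_in: "y \<in> snd c ` fst c \<Longrightarrow> chart_inv c y \<in> fst c"
  by (simp add: chart_inv_def inv_into_into)

lemma chart_inv_right: "y \<in> snd c ` fst c \<Longrightarrow> snd c (chart_inv c y) = y"
  by (simp add: chart_inv_def f_inv_into_f)

lemma chart_continuous:
  "c \<in> A \<Longrightarrow> continuous_map (subtopology X (fst c)) euclidean (snd c)"
  using homeomorphic_imp_continuous_map[OF chart_homeo] continuous_map_in_subtopology by blast

text \<open>The homeomorphism comes with some continuous inverse; injectivity of the chart
  identifies it with \<open>chart_inv c\<close> on the coordinate image.\<close>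

lemma chart_inv_continuous:
  assumes "c \<in> A"
  shows "continuous_map (top_of_set (snd c ` fst c)) X (chart_inv c)"
proof -
  obtain h where h: "homeomorphic_maps (subtopology X (fst c)) (top_of_set (snd c ` fst c)) (snd c) h"
    using chart_homeo[OF assms] homeomorphic_map_maps by blast
  have "h y = chart_inv c y" if "y \<in> snd c ` fst c" for y
    using h that openin_subset[OF chart_open[OF assms]] chart_inv_left[OF assms]
    by (auto simp: homeomorphic_maps_def)
  moreover have "continuous_map (top_of_set (snd c ` fst c)) X h"
    using h by (simp add: homeomorphic_maps_def continuous_map_in_subtopology)
  ultimately show ?thesis
    by (auto intro: continuous_map_eq)
qed

lemma chart_image_openin:
  assumes "c \<in> A" "openin X U"
  shows "open (snd c ` (fst c \<inter> U))"
proof -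
  have "openin (subtopology X (fst c)) (fst c \<inter> U)"
    using assms(2) by (metis Int_commute openin_subtopology)
  then have "openin (top_of_set (snd c ` fst c)) (snd c ` (fst c \<inter> U))"
    using homeomorphic_imp_open_map[OF chart_homeo[OF assms(1)]] by (simp add: open_map_def)
  then show ?thesis
    using chart_image_open[OF assms(1)] openin_open_trans by blast
qed

lemma charts_atD: "c \<in> charts_at A p \<Longrightarrow> c \<in> A" "c \<in> charts_at A p \<Longrightarrow> p \<in> fst c"
  by (auto simp: charts_at_def)

lemma topspace_charts: "topspace X = (\<Union>c\<in>A. fst c)"
  using manifold by (simp add: smooth_manifold_def smooth_atlas_def)

lemma in_topspace: "c \<in> charts_at A p \<Longrightarrow> p \<in> topspace X"
  by (auto simp: topspace_charts charts_at_def)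

lemma chart_at_in: "p \<in> topspace X \<Longrightarrow> chart_at A p \<in> charts_at A p"
  unfolding chart_at_def by (rule someI_ex) (auto simp: topspace_charts charts_at_def)

section \<open>Coordinate changes and tangent vectors in coordinates\<close>

lemma transition_has_derivative:
  assumes "c \<in> charts_at A p" "c' \<in> charts_at A p"
  shows "(transition c c' has_derivative frechet_derivative (transition c c') (at (snd c p)))
    (at (snd c p))"
proof -
  have "smooth_on (snd c ` (fst c \<inter> fst c')) (transition c c')"
    using manifold assms by (auto simp: smooth_manifold_def smooth_atlas_def charts_at_def)
  then have "transition c c' differentiable (at (snd c p))"
    by (rule smooth_on_differentiable) (use assms in \<open>auto simp: charts_at_def\<close>)
  then show ?thesis
    by (simp add: frechet_derivative_works)
qed

text \<open>The cocycle identity for Jacobians, by the chain rule. The composite agrees with the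
  direct coordinate change only over the overlap of \<open>c\<close> and \<open>c'\<close>, whose
  image is an open neighbourhood of \<open>snd c p\<close>.\<close>

lemma transition_comp:
  assumes "c \<in> charts_at A p" "c' \<in> charts_at A p" "c'' \<in> charts_at A p"
  shows "frechet_derivative (transition c' c'') (at (snd c' p))
    (frechet_derivative (transition c c') (at (snd c p)) v)
     = frechet_derivative (transition c c'') (at (snd c p)) v"
proof -
  have t: "transition c c' (snd c p) = snd c' p"
    using assms charts_atD chart_inv_left by (simp add: transition_def)
  have 1: "(transition c' c'' \<circ> transition c c' has_derivative
     frechet_derivative (transition c' c'') (at (snd c' p)) \<circ>
     frechet_derivative (transition c c') (at (snd c p))) (at (snd c p))"
    by (rule diff_chain_at) (simp_all add: transition_has_derivative assms t)
  have "(transition c c'' has_derivative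
     frechet_derivative (transition c' c'') (at (snd c' p)) \<circ>
     frechet_derivative (transition c c') (at (snd c p))) (at (snd c p))"
  proof (rule has_derivative_transform_within_open[OF 1])
    show "open (snd c ` (fst c \<inter> fst c'))"
      by (rule chart_image_openin) (use assms charts_atD chart_open in auto)
    show "snd c p \<in> snd c ` (fst c \<inter> fst c')"
      using assms charts_atD by blast
    show "(transition c' c'' \<circ> transition c c') y = transition c c'' y"
      if "y \<in> snd c ` (fst c \<inter> fst c')" for y
      using that assms by (auto simp: transition_def charts_at_def chart_inv_left)
  qed
  from frechet_derivative_at[OF this] show ?thesis
    by (metis comp_apply)
qed

lemma transition_self:
  assumes "c \<in> charts_at A p"
  shows "frechet_derivative (transition c c) (at (snd c p)) v = v"
proof -
  have "(transition c c has_derivative (\<lambda>v. v)) (at (snd c p))"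
  proof (rule has_derivative_transform_within_open[OF has_derivative_ident])
    show "open (snd c ` fst c)" "snd c p \<in> snd c ` fst c"
      using assms charts_atD chart_image_open by auto
    show "y = transition c c y" if "y \<in> snd c ` fst c" for y
      using chart_inv_right[OF that] by (simp add: transition_def)
  qed
  from frechet_derivative_at[OF this] show ?thesis by metis
qed

lemma tangent_of_in:
  assumes "c \<in> charts_at A p"
  shows "tangent_of A c p v \<in> tangent_space A p"
  using transition_comp[OF assms] by (simp add: tangent_space_def tangent_of_def)

lemma tangent_of_self: "c \<in> charts_at A p \<Longrightarrow> tangent_of A c p v c = v"
  by (simp add: tangent_of_def transition_self)

text \<open>With \<open>tangent_of_self\<close> this identifies the tangent space at
  \<open>p\<close> with the coordinate space of any chart. The default value \<open>0\<close> off
  \<open>charts_at A p\<close> makes it an equality of functions.\<close>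

lemma tangent_of_component:
  assumes "c \<in> charts_at A p" "\<xi> \<in> tangent_space A p"
  shows "tangent_of A c p (\<xi> c) = \<xi>"
proof
  fix c'
  show "tangent_of A c p (\<xi> c) c' = \<xi> c'"
  proof (cases "c' \<in> charts_at A p")
    case True
    then have "\<xi> c' = frechet_derivative (transition c c') (at (snd c p)) (\<xi> c)"
      using assms unfolding tangent_space_def by blast
    then show ?thesis
      using True by (simp only: tangent_of_def if_True)
  next
    case False
    then have "\<xi> c' = 0"
      using assms unfolding tangent_space_def by blast
    then show ?thesis
      using False by (simp only: tangent_of_def if_False)
  qed
qed

lemma tangent_of_lincomb:
  assumes "c \<in> charts_at A p"
  shows "tangent_of A c p (r *\<^sub>R v + s *\<^sub>R w)
    = (\<lambda>c'. r *\<^sub>R tangent_of A c p v c' + s *\<^sub>R tangent_of A c p w c')"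
proof
  fix c'
  show "tangent_of A c p (r *\<^sub>R v + s *\<^sub>R w) c'
    = r *\<^sub>R tangent_of A c p v c' + s *\<^sub>R tangent_of A c p w c'"
  proof (cases "c' \<in> charts_at A p")
    case True
    then have "linear (frechet_derivative (transition c c') (at (snd c p)))"
      using transition_has_derivative[OF assms] has_derivative_linear by blast
    then show ?thesis
      using True by (simp add: tangent_of_def linear_add linear_cmul)
  qed (simp add: tangent_of_def)
qed

section \<open>The metric and the gradient in coordinates\<close>

lemma metric_sym:
  "p \<in> topspace X \<Longrightarrow> \<xi> \<in> tangent_space A p \<Longrightarrow> \<eta> \<in> tangent_space A p \<Longrightarrow> g p \<xi> \<eta> = g p \<eta> \<xi>"
  using metric by (simp add: riemannian_metric_def)

lemma metric_lincomb:
  "p \<in> topspace X \<Longrightarrow> \<xi> \<in> tangent_space A p \<Longrightarrow> \<eta> \<in> tangent_space A p \<Longrightarrow> \<zeta> \<in> tangent_space A p \<Longrightarrow>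
   g p (\<lambda>c. r *\<^sub>R \<xi> c + s *\<^sub>R \<eta> c) \<zeta> = r * g p \<xi> \<zeta> + s * g p \<eta> \<zeta>"
  using metric by (simp add: riemannian_metric_def)

lemma metric_pos:
  "p \<in> topspace X \<Longrightarrow> \<xi> \<in> tangent_space A p \<Longrightarrow> \<xi> \<noteq> (\<lambda>_. 0) \<Longrightarrow> g p \<xi> \<xi> > 0"
  using metric by (simp add: riemannian_metric_def)

text \<open>The definition of a metric gives linearity in the first argument; symmetry carries it
  over to the second.\<close>

lemma bilinear_metric:
  assumes "c \<in> charts_at A p"
  shows "bilinear (\<lambda>v w. g p (tangent_of A c p v) (tangent_of A c p w))"
proof -
  note p = in_topspace[OF assms]
  have L: "g p (tangent_of A c p (r *\<^sub>R v + s *\<^sub>R w)) (tangent_of A c p z) =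
    r * g p (tangent_of A c p v) (tangent_of A c p z)
    + s * g p (tangent_of A c p w) (tangent_of A c p z)" for r s v w z
    by (simp add: tangent_of_lincomb[OF assms] metric_lincomb[OF p] tangent_of_in[OF assms])
  have l1: "linear (\<lambda>v. g p (tangent_of A c p v) (tangent_of A c p z))" for z
    using L[of 1 _ 1] L[of _ _ 0] by (intro linearI) auto
  show ?thesis
    unfolding bilinear_def
    using l1 metric_sym[OF p tangent_of_in[OF assms] tangent_of_in[OF assms]] by simp
qed

text \<open>Expressing the metric by its matrix makes the smoothness of the matrix entries available
  for the continuity of the speed of a curve.\<close>

lemma metric_coordinates:
  assumes "c \<in> charts_at A p"
  shows "g p (tangent_of A c p v) (tangent_of A c p w) =
    (\<Sum>i\<in>UNIV. \<Sum>j\<in>UNIV. v $ i * w $ j * metric_matrix A g c (snd c p) $ i $ j)"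
proof -
  let ?B = "\<lambda>v w. g p (tangent_of A c p v) (tangent_of A c p w)"
  have B: "linear (\<lambda>v. ?B v w)" "linear (?B v)" for v w
    using bilinear_metric[OF assms] by (auto simp: bilinear_def)
  have M: "metric_matrix A g c (snd c p) $ i $ j = ?B (axis i 1) (axis j 1)" for i j
    using assms charts_atD chart_inv_left by (simp add: metric_matrix_def Let_def)
  have "?B v w = (\<Sum>i\<in>UNIV. v $ i * ?B (axis i 1) w)"
    by (subst axis_expansion[of v]) (simp add: linear_sum[OF B(1)] linear_cmul[OF B(1)])
  also have "\<dots> = (\<Sum>i\<in>UNIV. v $ i * (\<Sum>j\<in>UNIV. w $ j * ?B (axis i 1) (axis j 1)))"
    by (subst axis_expansion[of w]) (simp add: linear_sum[OF B(2)] linear_cmul[OF B(2)])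
  finally show ?thesis
    by (simp add: M sum_distrib_left mult.assoc)
qed

lemma metric_nonneg:
  assumes "p \<in> topspace X" "\<xi> \<in> tangent_space A p"
  shows "g p \<xi> \<xi> \<ge> 0"
proof (cases "\<xi> = (\<lambda>_. 0)")
  case True
  then show ?thesis
    using metric_lincomb[of p \<xi> \<xi> \<xi> 0 0] assms by simp
next
  case False
  then show ?thesis
    using metric_pos assms by (simp add: less_imp_le)
qed

lemma tangent_norm_square:
  "p \<in> topspace X \<Longrightarrow> \<xi> \<in> tangent_space A p \<Longrightarrow> (tangent_norm g p \<xi>)\<^sup>2 = g p \<xi> \<xi>"
  by (simp add: tangent_norm_def metric_nonneg)

text \<open>\<open>gradient\<close> is a definite description, so its properties require existence
  and uniqueness of the vector representing the differential. Both follow from nondegeneracy of the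
  metric in the coordinates of one chart.\<close>

lemma gradient_props:
  assumes p: "p \<in> topspace X"
    and diff: "(w \<circ> chart_inv (chart_at A p)) differentiable (at (snd (chart_at A p) p))"
  shows "gradient A g w p \<in> tangent_space A p"
    and "\<And>\<eta>. \<eta> \<in> tangent_space A p \<Longrightarrow> g p (gradient A g w p) \<eta> = differential A w p \<eta>"
proof -
  define c where "c = chart_at A p"
  have c: "c \<in> charts_at A p" using chart_at_in[OF p] by (simp add: c_def)
  let ?T = "tangent_of A c p"
  let ?B = "\<lambda>v w. g p (?T v) (?T w)"
  let ?d = "frechet_derivative (w \<circ> chart_inv c) (at (snd c p))"
  have ld: "linear ?d"
    using diff unfolding c_def by (simp add: linear_frechet_derivative)
  have B: "linear (\<lambda>v. ?B v z)" "linear (?B v)" for v z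
    using bilinear_metric[OF c] by (auto simp: bilinear_def)
  have zero: "v = 0" if "?B v v = 0" for v
  proof -
    have "?T v = (\<lambda>_. 0)"
      using metric_pos[OF p tangent_of_in[OF c]] that by fastforce
    then show ?thesis using tangent_of_self[OF c] by metis
  qed
  have ext: "f1 z = f2 z" if "linear f1" "linear f2" "\<And>j. f1 (axis j 1) = f2 (axis j 1)"
    for f1 f2 :: "real ^ 'n \<Rightarrow> real" and z
    by (subst (1 2) axis_expansion[of z])
      (simp add: linear_sum[OF that(1)] linear_sum[OF that(2)] linear_cmul[OF that(1)]
        linear_cmul[OF that(2)] that(3))
  let ?m = "\<lambda>v. \<chi> j. ?B v (axis j 1)"
  have lm: "linear ?m"
    by (rule linearI) (auto simp: vec_eq_iff linear_add[OF B(1)] linear_cmul[OF B(1)])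
  \<comment> \<open>\<open>?m\<close> lists the pairings of \<open>v\<close> with the basis vectors.
    If all of them vanish, so does the pairing of \<open>v\<close> with itself, and definiteness
    gives \<open>v = 0\<close>. In finite dimension \<open>?m\<close> is then onto, which produces
    the gradient.\<close>
  have "inj ?m"
  proof (rule linear_injective_0[OF lm, THEN iffD2], intro allI impI)
    fix v assume "?m v = 0"
    then have "\<And>j. ?B v (axis j 1) = 0" by (simp add: vec_eq_iff)
    then have "?B v v = 0"
      using ext[OF B(2)[of v] module_hom_zero, of v] by simp
    then show "v = 0" by (rule zero)
  qed
  then have "surj ?m" using linear_inj_imp_surj[OF lm] by blast
  then obtain v where v: "(\<chi> j. ?d (axis j 1)) = ?m v"
    using surjD[of ?m "\<chi> j. ?d (axis j 1)"] by blast
  have v': "?B v (axis j 1) = ?d (axis j 1)" for j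
    using arg_cong[OF v, of "\<lambda>x. x $ j"] by simp
  have Bv: "?B v z = ?d z" for z
    by (rule ext[OF B(2) ld v'])
  let ?P = "\<lambda>\<xi>. \<xi> \<in> tangent_space A p \<and>
            (\<forall>\<eta>\<in>tangent_space A p. g p \<xi> \<eta> = differential A w p \<eta>)"
  have P: "?P (?T v)"
  proof (intro conjI ballI tangent_of_in[OF c])
    fix \<eta> assume "\<eta> \<in> tangent_space A p"
    then show "g p (?T v) \<eta> = differential A w p \<eta>"
      using Bv[of "\<eta> c"] tangent_of_component[OF c]
      by (simp add: differential_def Let_def c_def)
  qed
  have uniq: "\<xi> = ?T v" if "?P \<xi>" for \<xi>
  proof -
    have \<xi>: "\<xi> = ?T (\<xi> c)" using that tangent_of_component[OF c] by simp
    have "?B (\<xi> c) z = ?B v z" for z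
      using that P tangent_of_in[OF c] \<xi>[symmetric] by simp
    then have "?B (\<xi> c - v) (\<xi> c - v) = 0"
      by (simp add: linear_diff[OF B(1)])
    then have "\<xi> c = v" using zero by fastforce
    then show ?thesis using \<xi> by simp
  qed
  have "?P (gradient A g w p)"
    unfolding gradient_def by (rule theI[where P = ?P, OF P uniq])
  then show "gradient A g w p \<in> tangent_space A p"
    and "\<And>\<eta>. \<eta> \<in> tangent_space A p \<Longrightarrow> g p (gradient A g w p) \<eta> = differential A w p \<eta>"
    by auto
qed

end

section \<open>Smooth curves\<close>

text \<open>The counterpart of \<open>smooth_path\<close> on an open set, where all derivatives are
  two-sided and restriction to smaller open sets is unproblematic.\<close>

definition smooth_curve ::
  "'a topology \<Rightarrow> ('a, 'n::finite) chart set \<Rightarrow> real set \<Rightarrow> (real \<Rightarrow> 'a) \<Rightarrow> bool" where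
  "smooth_curve X A I m \<longleftrightarrow> open I \<and> continuous_map (top_of_set I) X m \<and>
     (\<forall>c\<in>A. smooth_on (I \<inter> m -` fst c) (snd c \<circ> m))"

text \<open>Unlike \<open>velocity\<close>, this does not refer to an interval, so the pieces of a
  path and the whole path have literally the same velocity away from their end points.\<close>

definition curve_velocity ::
  "('a, 'n::finite) chart set \<Rightarrow> (real \<Rightarrow> 'a) \<Rightarrow> real \<Rightarrow> ('a, 'n) tangent" where
  "curve_velocity A m t =
     (\<lambda>c. if c \<in> charts_at A (m t) then vector_derivative (snd c \<circ> m) (at t) else 0)"

text \<open>\<open>vector_derivative\<close> chooses among all derivatives at the point, so it
  suffices that both curves have the same derivatives \<open>d\<close>.\<close>

lemma curve_velocity_cong:
  fixes A :: "('a, 'n::finite) chart set"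
  assumes "open J" "t \<in> J" "\<And>s. s \<in> J \<Longrightarrow> m s = l s"
  shows "curve_velocity A m t = curve_velocity A l t"
proof
  fix c :: "('a, 'n) chart"
  have "(snd c \<circ> m has_vector_derivative d) (at t) \<longleftrightarrow> (snd c \<circ> l has_vector_derivative d) (at t)"
    for d
  proof
    assume "(snd c \<circ> m has_vector_derivative d) (at t)"
    then show "(snd c \<circ> l has_vector_derivative d) (at t)"
      by (rule has_vector_derivative_transform_within_open[OF _ assms(1,2)]) (simp add: assms(3))
  next
    assume "(snd c \<circ> l has_vector_derivative d) (at t)"
    then show "(snd c \<circ> m has_vector_derivative d) (at t)"
      by (rule has_vector_derivative_transform_within_open[OF _ assms(1,2)]) (simp add: assms(3))
  qed
  then show "curve_velocity A m t c = curve_velocity A l t c"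
    using assms(2,3) by (simp add: curve_velocity_def vector_derivative_def)
qed

lemma velocity_interior:
  assumes "t \<in> {a<..<b}"
  shows "velocity A a b l t = curve_velocity A l t"
proof -
  have "at t within {a..b} = at t"
    using assms by (simp add: at_within_Icc_at)
  then show ?thesis
    by (simp only: velocity_def curve_velocity_def)
qed

context riemannian begin

section \<open>Curves read in charts, their velocity and their speed\<close>

lemma curve_chart_openin:
  assumes "continuous_map (top_of_set T) X l" "openin X U"
  shows "openin (top_of_set T) (T \<inter> l -` U)"
proof -
  have "T \<inter> l -` U = {x \<in> topspace (top_of_set T). l x \<in> U}" by auto
  then show ?thesis
    using openin_continuous_map_preimage[OF assms] by (simp only:)
qed

lemma curve_chart_continuous:
  assumes "continuous_map (top_of_set T) X l" "c \<in> A"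
  shows "continuous_on (T \<inter> l -` fst c) (snd c \<circ> l)"
proof -
  have "continuous_map (top_of_set (T \<inter> l -` fst c)) (subtopology X (fst c)) l"
    unfolding continuous_map_in_subtopology
    using continuous_map_from_subtopology_mono[OF assms(1), of "T \<inter> l -` fst c"] by auto
  then have "continuous_map (top_of_set (T \<inter> l -` fst c)) euclidean (snd c \<circ> l)"
    using chart_continuous[OF assms(2)] continuous_map_compose by blast
  then show ?thesis by simp
qed

lemma smooth_curve_subset:
  assumes "smooth_curve X A I m" "open J" "J \<subseteq> I" "\<And>t. t \<in> J \<Longrightarrow> m t = l t"
  shows "smooth_curve X A J l"
proof -
  have cm: "continuous_map (top_of_set J) X m"
    using assms(1,3) continuous_map_from_subtopology_mono by (auto simp: smooth_curve_def)
  have "smooth_on (J \<inter> l -` fst c) (snd c \<circ> l)" if c: "c \<in> A" for c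
  proof -
    have eq: "J \<inter> l -` fst c = J \<inter> m -` fst c" using assms(4) by auto
    have o: "open (J \<inter> m -` fst c)"
      using curve_chart_openin[OF cm chart_open[OF c]] assms(2) openin_open_trans by blast
    have "smooth_on (J \<inter> m -` fst c) (snd c \<circ> m)"
      by (rule smooth_on_subset[of "I \<inter> m -` fst c"])
        (use assms(1,3) c in \<open>auto simp: smooth_curve_def\<close>)
    then have "smooth_on (J \<inter> m -` fst c) (snd c \<circ> l)"
      by (rule smooth_on_cong[OF o, rotated]) (auto simp: assms(4))
    then show ?thesis by (simp only: eq)
  qed
  moreover have "continuous_map (top_of_set J) X l"
    using cm by (rule continuous_map_eq) (simp add: assms(4))
  ultimately show ?thesis using assms(2) by (simp add: smooth_curve_def)
qed

lemma smooth_path_curve: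
  assumes "smooth_path X A a b l"
  shows "smooth_curve X A {a<..<b} l"
proof -
  obtain e m where e: "e > 0" and m: "smooth_curve X A {a - e<..<b + e} m"
    and eq: "\<And>t. t \<in> {a..b} \<Longrightarrow> m t = l t"
    using assms unfolding smooth_path_def smooth_curve_def by (metis open_greaterThanLessThan)
  show ?thesis
    by (rule smooth_curve_subset[OF m]) (use e eq in auto)
qed

lemma smooth_path_continuous:
  assumes "smooth_path X A a b l"
  shows "continuous_map (top_of_set {a..b}) X l"
proof -
  obtain e m where e: "e > 0" and m: "continuous_map (top_of_set {a - e<..<b + e}) X m"
    and eq: "\<forall>t\<in>{a..b}. m t = l t"
    using assms unfolding smooth_path_def by blast
  have "continuous_map (top_of_set {a..b}) X m"
    by (rule continuous_map_from_subtopology_mono[OF m]) (use e in auto)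
  then show ?thesis by (rule continuous_map_eq) (simp add: eq)
qed

lemma smooth_curve_topspace: "smooth_curve X A I m \<Longrightarrow> t \<in> I \<Longrightarrow> m t \<in> topspace X"
  using continuous_map_image_subset_topspace[of "top_of_set I" X m]
  unfolding smooth_curve_def by (simp add: image_subset_iff)

lemma smooth_curve_open:
  assumes "smooth_curve X A I m" "c \<in> A"
  shows "open (I \<inter> m -` fst c)"
proof -
  have "openin (top_of_set I) (I \<inter> m -` fst c)" "open I"
    using curve_chart_openin[OF _ chart_open[OF assms(2)]] assms(1) by (auto simp: smooth_curve_def)
  then show ?thesis by (rule openin_open_trans)
qed

lemma curve_has_velocity:
  assumes "smooth_curve X A I m" "t \<in> I" "c \<in> charts_at A (m t)"
  shows "((snd c \<circ> m) has_vector_derivative curve_velocity A m t c) (at t)"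
proof -
  have "(snd c \<circ> m) differentiable (at t)"
    by (rule smooth_on_differentiable[of "I \<inter> m -` fst c"])
      (use assms in \<open>auto simp: smooth_curve_def charts_at_def\<close>)
  then show ?thesis
    using assms(3) by (simp add: curve_velocity_def vector_derivative_works)
qed

text \<open>In a second chart the curve is, near \<open>t\<close>, the coordinate change applied to
  its expression in the first; the chain rule gives the transformation law of the
  components.\<close>

lemma curve_velocity_tangent:
  assumes m: "smooth_curve X A I m" and t: "t \<in> I"
  shows "curve_velocity A m t \<in> tangent_space A (m t)"
proof -
  have "curve_velocity A m t c' =
      frechet_derivative (transition c c') (at (snd c (m t))) (curve_velocity A m t c)"
    if c: "c \<in> charts_at A (m t)" and c': "c' \<in> charts_at A (m t)" for c c'
  proof -
    let ?D = "frechet_derivative (transition c c') (at (snd c (m t)))"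
    have D: "((transition c c' \<circ> (snd c \<circ> m)) has_vector_derivative ?D (curve_velocity A m t c)) (at t)"
      by (rule vector_derivative_diff_chain_within[OF curve_has_velocity[OF m t c]])
        (simp add: transition_has_derivative[OF c c'] has_derivative_at_withinI)
    have "((snd c' \<circ> m) has_vector_derivative ?D (curve_velocity A m t c)) (at t)"
    proof (rule has_vector_derivative_transform_within_open[OF D])
      show "open (I \<inter> m -` fst c)" "t \<in> I \<inter> m -` fst c"
        using smooth_curve_open[OF m] t c charts_atD by auto
      show "(transition c c' \<circ> (snd c \<circ> m)) s = (snd c' \<circ> m) s" if "s \<in> I \<inter> m -` fst c" for s
        using that charts_atD(1)[OF c] by (simp add: transition_def chart_inv_left)
    qed
    then show ?thesis
      using curve_has_velocity[OF m t c'] vector_derivative_unique_at by blast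
  qed
  moreover have "curve_velocity A m t c = 0" if "c \<notin> charts_at A (m t)" for c
    using that by (simp add: curve_velocity_def)
  ultimately show ?thesis
    unfolding tangent_space_def by blast
qed

text \<open>Continuity is local: near \<open>t0\<close> one chart contains the curve, and there the
  speed is the square root of a polynomial in velocity components and metric entries, all
  continuous.\<close>

lemma curve_speed_continuous:
  assumes m: "smooth_curve X A I m"
  shows "continuous_on I (\<lambda>t. tangent_norm g (m t) (curve_velocity A m t))"
proof -
  have "isCont (\<lambda>t. tangent_norm g (m t) (curve_velocity A m t)) t0" if t0: "t0 \<in> I" for t0
  proof -
    define c where "c = chart_at A (m t0)"
    have c0: "c \<in> charts_at A (m t0)" and cA: "c \<in> A"
      using chart_at_in[OF smooth_curve_topspace[OF m t0]] charts_atD by (auto simp: c_def)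
    let ?J = "I \<inter> m -` fst c"
    let ?y' = "\<lambda>t. vector_derivative (snd c \<circ> m) (at t)"
    let ?q = "\<lambda>t. sqrt (\<Sum>i\<in>UNIV. \<Sum>j\<in>UNIV. ?y' t $ i * ?y' t $ j
        * metric_matrix A g c ((snd c \<circ> m) t) $ i $ j)"
    have J: "open ?J" "t0 \<in> ?J"
      using smooth_curve_open[OF m cA] t0 c0 charts_atD by auto
    have sm: "smooth_on ?J (snd c \<circ> m)"
      using m cA by (simp add: smooth_curve_def)
    have M: "continuous_on ?J (\<lambda>t. metric_matrix A g c ((snd c \<circ> m) t) $ i $ j)" for i j
    proof (rule continuous_on_compose2[OF _ smooth_on_continuous[OF sm]])
      show "continuous_on (snd c ` fst c) (\<lambda>y. metric_matrix A g c y $ i $ j)"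
        using metric cA smooth_on_continuous unfolding riemannian_metric_def by blast
    qed auto
    have "continuous_on ?J (\<lambda>t. ?y' t $ i)" for i
      using smooth_on_vector_derivative_continuous[OF sm] by (rule continuous_on_component)
    then have "continuous_on ?J ?q"
      using M by (intro continuous_on_real_sqrt continuous_on_sum continuous_on_mult)
    moreover have "tangent_norm g (m t) (curve_velocity A m t) = ?q t" if "t \<in> ?J" for t
    proof -
      have ct: "c \<in> charts_at A (m t)" using that cA by (auto simp: charts_at_def)
      have "curve_velocity A m t = tangent_of A c (m t) (?y' t)"
        using tangent_of_component[OF ct curve_velocity_tangent[OF m]] that ct
        by (metis Int_iff curve_velocity_def)
      then show ?thesis
        using metric_coordinates[OF ct] by (simp add: tangent_norm_def)
    qed
    ultimately have "continuous_on ?J (\<lambda>t. tangent_norm g (m t) (curve_velocity A m t))"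
      by (simp cong: continuous_on_cong_simp)
    then show ?thesis
      using J continuous_on_eq_continuous_at by blast
  qed
  then show ?thesis
    by (simp add: continuous_at_imp_continuous_on)
qed

text \<open>The smooth extension past the end points supplies \<open>q\<close>. This makes the speed
  integrable, since values at the two end points do not affect the integral.\<close>

lemma smooth_path_speed:
  assumes "smooth_path X A a b l"
  obtains q where "continuous_on {a..b} q"
    "\<And>t. t \<in> {a<..<b} \<Longrightarrow> tangent_norm g (l t) (curve_velocity A l t) = q t"
proof -
  obtain e m where e: "e > 0" and m: "smooth_curve X A {a - e<..<b + e} m"
    and eq: "\<And>t. t \<in> {a..b} \<Longrightarrow> m t = l t"
    using assms unfolding smooth_path_def smooth_curve_def by (metis open_greaterThanLessThan)
  show ?thesis
  proof (rule that[of "\<lambda>t. tangent_norm g (m t) (curve_velocity A m t)"])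
    show "continuous_on {a..b} (\<lambda>t. tangent_norm g (m t) (curve_velocity A m t))"
      by (rule continuous_on_subset[OF curve_speed_continuous[OF m]]) (use e in auto)
    show "tangent_norm g (l t) (curve_velocity A l t) = tangent_norm g (m t) (curve_velocity A m t)"
      if t: "t \<in> {a<..<b}" for t
      using curve_velocity_cong[OF open_greaterThanLessThan t, of m l A] eq t by simp
  qed
qed

text \<open>The chain rule for the solution in space-time coordinates, along the curve whose
  components are the chart expression of \<open>m\<close> and the clock \<tau>.\<close>

lemma log_solution_derivative:
  assumes u: "smooth_spacetime A u" and pos: "\<forall>x\<in>topspace X. \<forall>t>0. u x t > 0"
    and m: "smooth_curve X A I m" and s: "s \<in> I"
    and \<tau>: "(\<tau> has_real_derivative \<tau>') (at s)" "\<tau> s > 0"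
  defines "w \<equiv> \<lambda>y. u y (\<tau> s)"
  shows "gradient A g w (m s) \<in> tangent_space A (m s)"
    and "((\<lambda>s. ln (u (m s) (\<tau> s))) has_real_derivative
      (g (m s) (gradient A g w (m s)) (curve_velocity A m s) + \<tau>' * deriv (u (m s)) (\<tau> s))
        / u (m s) (\<tau> s)) (at s)"
proof -
  define p where "p = m s"
  have p: "p \<in> topspace X" using smooth_curve_topspace[OF m s] by (simp add: p_def)
  define c where "c = chart_at A p"
  have c: "c \<in> charts_at A p" and cA: "c \<in> A" and pc: "p \<in> fst c"
    using chart_at_in[OF p] charts_atD by (auto simp: c_def)
  let ?U = "\<lambda>z. u (chart_inv c (fst z)) (snd z)"
  define y where "y = snd c p"
  have inv: "chart_inv c y = p" using chart_inv_left[OF cA pc] by (simp add: y_def)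
  have "smooth_on ((snd c ` fst c) \<times> {0<..}) ?U"
    using u cA by (simp add: smooth_spacetime_def)
  then have "?U differentiable (at (y, \<tau> s))"
    by (rule smooth_on_differentiable) (use pc \<tau>(2) in \<open>auto simp: y_def\<close>)
  then obtain D where D: "(?U has_derivative D) (at (y, \<tau> s))"
    by (auto simp: differentiable_def)
  have lD: "linear D" using D by (rule has_derivative_linear)
  \<comment> \<open>The joint derivative \<open>D\<close> is restricted to space, with time frozen
    at \<open>\<tau> s\<close>, and then to time, with the point frozen at \<open>p\<close>.\<close>
  have Dy: "((w \<circ> chart_inv c) has_derivative (\<lambda>v. D (v, 0))) (at y)"
  proof -
    have "((\<lambda>z. (z, \<tau> s)) has_derivative (\<lambda>v. (v, 0))) (at y)"
      by (auto intro!: derivative_eq_intros)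
    from diff_chain_at[OF this D] show ?thesis by (simp add: o_def w_def)
  qed
  have Dt: "(u p has_real_derivative D (0, 1)) (at (\<tau> s))"
  proof -
    have "((\<lambda>t. (y, t)) has_derivative (\<lambda>v. (0, v))) (at (\<tau> s))"
      by (auto intro!: derivative_eq_intros)
    from diff_chain_at[OF this D] have "(u p has_derivative (\<lambda>v. D (0, v))) (at (\<tau> s))"
      by (simp add: o_def inv)
    moreover have "(\<lambda>v. D (0, v)) = (*) (D (0, 1))"
    proof
      show "D (0, v) = D (0, 1) * v" for v
        using linear_cmul[OF lD, of v "(0, 1)"] by (simp only: scaleR_Pair) simp
    qed
    ultimately show ?thesis unfolding has_field_derivative_def by (simp only:)
  qed
  have df: "(w \<circ> chart_inv (chart_at A p)) differentiable (at (snd (chart_at A p) p))"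
    using Dy unfolding c_def[symmetric] y_def[symmetric] differentiable_def by blast
  note grad = gradient_props[OF p df]
  show "gradient A g w (m s) \<in> tangent_space A (m s)"
    using grad(1) by (simp add: p_def)
  let ?\<xi> = "curve_velocity A m s"
  have "g p (gradient A g w p) ?\<xi> = differential A w p ?\<xi>"
    using grad(2) curve_velocity_tangent[OF m s] by (simp add: p_def)
  also have "\<dots> = D (?\<xi> c, 0)"
    using frechet_derivative_at[OF Dy] by (metis c_def differential_def y_def)
  finally have gD: "g p (gradient A g w p) ?\<xi> = D (?\<xi> c, 0)" .
  have "((\<lambda>r. ((snd c \<circ> m) r, \<tau> r)) has_vector_derivative (?\<xi> c, \<tau>')) (at s)"
    using curve_has_velocity[OF m s c[unfolded p_def]] \<tau>(1)
    by (intro has_vector_derivative_Pair)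
      (simp_all only: has_real_derivative_iff_has_vector_derivative)
  then have "((\<lambda>r. ((snd c \<circ> m) r, \<tau> r)) has_derivative (\<lambda>h. h *\<^sub>R (?\<xi> c, \<tau>'))) (at s)"
    by (simp only: has_vector_derivative_def)
  from diff_chain_at[OF this, of ?U D] D
  have "((?U \<circ> (\<lambda>r. ((snd c \<circ> m) r, \<tau> r))) has_derivative (\<lambda>h. D (h *\<^sub>R (?\<xi> c, \<tau>')))) (at s)"
    by (simp add: o_def y_def p_def)
  moreover have "(\<lambda>h. D (h *\<^sub>R (?\<xi> c, \<tau>'))) = (*) (D (?\<xi> c, \<tau>'))"
    by (rule ext) (simp only: linear_cmul[OF lD] real_scaleR_def mult.commute)
  ultimately have U1: "((?U \<circ> (\<lambda>r. ((snd c \<circ> m) r, \<tau> r))) has_derivative (*) (D (?\<xi> c, \<tau>'))) (at s)"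
    by (simp only:)
  have "((\<lambda>r. u (m r) (\<tau> r)) has_real_derivative D (?\<xi> c, \<tau>')) (at s)"
    unfolding has_field_derivative_def
  proof (rule has_derivative_transform_within_open[OF U1])
    show "open (I \<inter> m -` fst c)" "s \<in> I \<inter> m -` fst c"
      using smooth_curve_open[OF m cA] s pc by (auto simp: p_def)
  qed (simp add: chart_inv_left[OF cA])
  \<comment> \<open>Linearity splits \<open>D\<close> into its space part, which is the pairing with
    the gradient, and \<open>\<tau>'\<close> times the time derivative.\<close>
  moreover have "D (?\<xi> c, \<tau>') = g p (gradient A g w p) ?\<xi> + \<tau>' * deriv (u p) (\<tau> s)"
    using linear_add[OF lD, of "(?\<xi> c, 0)" "(0, \<tau>')"] linear_cmul[OF lD, of \<tau>' "(0, 1)"] gD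
      DERIV_imp_deriv[OF Dt] by simp
  ultimately have "((\<lambda>r. u (m r) (\<tau> r)) has_real_derivative
      g p (gradient A g w p) ?\<xi> + \<tau>' * deriv (u p) (\<tau> s)) (at s)"
    by simp
  moreover have "u (m s) (\<tau> s) > 0" using pos p \<tau>(2) by (simp add: p_def)
  ultimately show "((\<lambda>s. ln (u (m s) (\<tau> s))) has_real_derivative
      (g (m s) (gradient A g w (m s)) (curve_velocity A m s) + \<tau>' * deriv (u (m s)) (\<tau> s))
        / u (m s) (\<tau> s)) (at s)"
    by (auto intro!: derivative_eq_intros simp: p_def)
qed

text \<open>The left-hand side is \<open>k\<close> times the squared length of
  \<open>\<eta> + \<xi> / (2 * k)\<close>.\<close>

lemma metric_weighted_young:
  assumes p: "p \<in> topspace X" and \<xi>: "\<xi> \<in> tangent_space A p" and \<eta>: "\<eta> \<in> tangent_space A p"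
    and k: "k > 0"
  shows "k * g p \<eta> \<eta> + g p \<eta> \<xi> + g p \<xi> \<xi> / (4 * k) \<ge> 0"
proof -
  define c where "c = chart_at A p"
  have c: "c \<in> charts_at A p" using chart_at_in[OF p] by (simp add: c_def)
  let ?B = "\<lambda>v w. g p (tangent_of A c p v) (tangent_of A c p w)"
  let ?r = "1 / (2 * k)"
  have B: "bilinear ?B" by (rule bilinear_metric[OF c])
  have sym: "?B v w = ?B w v" for v w
    using metric_sym[OF p tangent_of_in[OF c] tangent_of_in[OF c]] .
  have "0 \<le> ?B (\<eta> c + ?r *\<^sub>R \<xi> c) (\<eta> c + ?r *\<^sub>R \<xi> c)"
    using metric_nonneg[OF p tangent_of_in[OF c]] .
  also have "\<dots> = ?B (\<eta> c) (\<eta> c) + 2 * ?r * ?B (\<eta> c) (\<xi> c) + ?r * ?r * ?B (\<xi> c) (\<xi> c)"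
    using sym[of "\<xi> c" "\<eta> c"]
    by (simp only: bilinear_ladd[OF B] bilinear_radd[OF B] bilinear_lmul[OF B] bilinear_rmul[OF B])
      (simp add: algebra_simps)
  finally have "0 \<le> k * (g p \<eta> \<eta> + 2 * ?r * g p \<eta> \<xi> + ?r * ?r * g p \<xi> \<xi>)"
    using k \<xi> \<eta> by (simp only: tangent_of_component[OF c] mult_nonneg_nonneg less_imp_le)
  also have "\<dots> = k * g p \<eta> \<eta> + g p \<eta> \<xi> + g p \<xi> \<xi> / (4 * k)"
    using k by (simp add: field_simps)
  finally show ?thesis .
qed

end

section \<open>Existence of piecewise smooth paths\<close>

context riemannian begin

lemma smooth_path_cong:
  assumes "smooth_path X A a b l" "\<And>t. t \<in> {a..b} \<Longrightarrow> l t = l' t"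
  shows "smooth_path X A a b l'"
proof -
  obtain e m where "e > 0" "continuous_map (top_of_set {a - e<..<b + e}) X m"
    "\<forall>t\<in>{a..b}. m t = l t" "\<forall>c\<in>A. smooth_on ({a - e<..<b + e} \<inter> m -` fst c) (snd c \<circ> m)"
    using assms(1) unfolding smooth_path_def by blast
  with assms(2) show ?thesis
    unfolding smooth_path_def by (intro exI[of _ e] exI[of _ m] conjI) simp_all
qed

text \<open>The path is a straight coordinate segment. It stays in the chart by convexity of
  \<open>U\<close>, and openness of \<open>U\<close> lets it run a little past both ends, as
  \<open>smooth_path\<close> demands.\<close>

lemma chart_segment_smooth_path:
  assumes c: "c \<in> A" and U: "open U" "convex U" "U \<subseteq> snd c ` fst c" and yz: "y \<in> U" "z \<in> U"
    and ab: "a < b"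
  obtains l where "smooth_path X A a b l" "l a = chart_inv c y" "l b = chart_inv c z"
proof -
  \<comment> \<open>\<open>w\<close> is the constant velocity and \<open>y0\<close> the position at
    time \<open>0\<close> of the affine line passing through \<open>y\<close> at time
    \<open>a\<close> and through \<open>z\<close> at time \<open>b\<close>.\<close>
  define w where "w = (1 / (b - a)) *\<^sub>R (z - y)"
  define y0 where "y0 = y - a *\<^sub>R w"
  let ?h = "\<lambda>t. y0 + t *\<^sub>R w"
  let ?m = "\<lambda>t. chart_inv c (?h t)"
  have hc: "?h ((1 - r) * s + r * t) = (1 - r) *\<^sub>R ?h s + r *\<^sub>R ?h t" for r s t
    by (simp add: algebra_simps)
  have ha: "?h a = y" by (simp add: y0_def)
  have "?h b = y + (b - a) *\<^sub>R w" by (simp add: y0_def algebra_simps)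
  also have "\<dots> = z" using ab by (simp add: w_def)
  finally have hb: "?h b = z" .
  let ?T = "?h -` U"
  have oT: "open ?T"
    by (intro open_vimage U continuous_intros)
  have cT: "convex ?T"
    unfolding convex_alt
  proof (intro ballI allI impI)
    fix s t r :: real assume "s \<in> ?T" "t \<in> ?T" "0 \<le> r \<and> r \<le> 1"
    then show "(1 - r) *\<^sub>R s + r *\<^sub>R t \<in> ?T"
      using U(2) hc[of r s t] unfolding convex_alt by auto
  qed
  have abT: "a \<in> ?T" "b \<in> ?T" using ha hb yz by auto
  obtain e1 where e1: "e1 > 0" "ball a e1 \<subseteq> ?T" using oT abT(1) open_contains_ball by blast
  obtain e2 where e2: "e2 > 0" "ball b e2 \<subseteq> ?T" using oT abT(2) open_contains_ball by blast
  define e where "e = min e1 e2 / 2"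
  have e: "e > 0" "e < e1" "e < e2" using e1(1) e2(1) by (auto simp: e_def)
  have ends: "a - e \<in> ?T" "b + e \<in> ?T"
    using e e1(2) e2(2) by (auto simp: subset_iff dist_real_def)
  let ?I = "{a - e<..<b + e}"
  \<comment> \<open>The times at which the line lies in \<open>U\<close> form a convex set, so it is
    enough that the two enlarged end times belong to it.\<close>
  have "closed_segment (a - e) (b + e) \<subseteq> ?T"
    using closed_segment_subset[OF ends cT] .
  then have "{a - e..b + e} \<subseteq> ?T"
    using ab e(1) by (simp add: closed_segment_eq_real_ivl)
  then have "?I \<subseteq> ?T"
    using greaterThanLessThan_subseteq_atLeastAtMost_iff by blast
  then have IU: "?h t \<in> snd c ` fst c" if "t \<in> ?I" for t
    using that U(3) by blast
  have "continuous_on ?I ?h" by (intro continuous_intros)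
  then have "continuous_map (top_of_set ?I) (top_of_set (snd c ` fst c)) ?h"
    using IU by (auto simp: continuous_map_in_subtopology)
  from continuous_map_compose[OF this chart_inv_continuous[OF c]]
  have cm: "continuous_map (top_of_set ?I) X ?m"
    by (simp only: o_def)
  have sm: "smooth_on (?I \<inter> ?m -` fst c') (snd c' \<circ> ?m)" if c': "c' \<in> A" for c'
  proof -
    let ?J = "?I \<inter> ?m -` fst c'"
    have oJ: "open ?J"
      using curve_chart_openin[OF cm chart_open[OF c']] openin_open_trans
        open_greaterThanLessThan by blast
    have J: "?h t \<in> snd c ` (fst c \<inter> fst c')" if "t \<in> ?J" for t
    proof -
      have "?h t \<in> snd c ` fst c" using that IU by blast
      from chart_inv_in[OF this] chart_inv_right[OF this] show ?thesis
        using that by (metis IntD2 IntI image_eqI vimageE)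
    qed
    have S: "smooth_on (snd c ` (fst c \<inter> fst c')) (transition c c')"
      using manifold c c' by (simp add: smooth_manifold_def smooth_atlas_def)
    \<comment> \<open>Seen in another chart \<open>c'\<close>, the segment is a coordinate change
      composed with an affine line.\<close>
    have "smooth_on ?J (\<lambda>t. transition c c' (?h t))"
      unfolding smooth_on_def
    proof
      show "Ck_on k ?J (\<lambda>t. transition c c' (?h t))" for k
        by (rule Ck_on_compose_line[OF chart_image_openin[OF c chart_open[OF c']] oJ J])
          (use S in \<open>simp_all add: smooth_on_def\<close>)
    qed
    then show ?thesis by (simp add: transition_def o_def)
  qed
  have "smooth_path X A a b ?m"
    unfolding smooth_path_def using e(1) cm sm by blast
  from that[OF this] show ?thesis using ha hb by simp
qed

text \<open>Ending before time \<open>1\<close> leaves room for one more segment, so paths never have to be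
  reparametrized.\<close>

definition reachable :: "'a \<Rightarrow> 'a \<Rightarrow> bool" where
  "reachable x y \<longleftrightarrow> (\<exists>b l. 0 \<le> b \<and> b < 1 \<and> piecewise_smooth_path X A 0 b l \<and> l 0 = x \<and> l b = y)"

text \<open>Adding \<open>b'\<close> to the partition creates exactly one new piece, from
  \<open>b\<close> to \<open>b'\<close>; the condition \<open>k b = l b\<close> makes the glued path
  agree with \<open>k\<close> on all of it.\<close>

lemma piecewise_smooth_path_extend:
  assumes l: "piecewise_smooth_path X A a b l" and ab: "a \<le> b" "b < b'"
    and k: "smooth_path X A b b' k" "k b = l b"
  shows "piecewise_smooth_path X A a b' (\<lambda>t. if t \<le> b then l t else k t)"
proof -
  let ?j = "\<lambda>t. if t \<le> b then l t else k t"
  obtain P where P: "finite P" "{a, b} \<subseteq> P" "P \<subseteq> {a..b}"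
    and sm: "\<forall>r\<in>P. \<forall>s\<in>P. r < s \<and> {r<..<s} \<inter> P = {} \<longrightarrow> smooth_path X A r s l"
    using l unfolding piecewise_smooth_path_def by blast
  have cl: "continuous_map (top_of_set {a..b}) X l"
    using l by (simp add: piecewise_smooth_path_def)
  have ck: "continuous_map (top_of_set {b..b'}) X k"
    by (rule smooth_path_continuous[OF k(1)])
  have cj: "continuous_map (top_of_set {a..b'}) X ?j"
  proof (rule continuous_map_cases_le[where p = "\<lambda>t. t" and q = "\<lambda>_. b"])
    have "{x \<in> topspace (top_of_set {a..b'}). x \<le> b} = {a..b}" using ab by auto
    then show "continuous_map (subtopology (top_of_set {a..b'})
        {x \<in> topspace (top_of_set {a..b'}). x \<le> b}) X l"
      using cl ab by (simp add: subtopology_subtopology Int_absorb1)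
    have "{x \<in> topspace (top_of_set {a..b'}). b \<le> x} = {b..b'}" using ab by auto
    then show "continuous_map (subtopology (top_of_set {a..b'})
        {x \<in> topspace (top_of_set {a..b'}). b \<le> x}) X k"
      using ck ab by (simp add: subtopology_subtopology Int_absorb1)
  qed (use k(2) in \<open>auto intro: continuous_on_id\<close>)
  have "smooth_path X A r s ?j"
    if rs: "r \<in> insert b' P" "s \<in> insert b' P" "r < s" "{r<..<s} \<inter> insert b' P = {}" for r s
  proof (cases "s = b'")
    case True
    then have "r \<in> P" using rs by auto
    then have "r \<le> b" using P(3) by auto
    \<comment> \<open>Otherwise \<open>b\<close>, which belongs to \<open>P\<close>, would lie
      strictly between \<open>r\<close> and \<open>b'\<close>.\<close>
    moreover have "\<not> r < b" using rs(4) P(2) True ab by auto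
    ultimately have "r = b" by simp
    moreover have "smooth_path X A b b' ?j"
      by (rule smooth_path_cong[OF k(1)]) (use k(2) in auto)
    ultimately show ?thesis using True by simp
  next
    case False
    then have "s \<in> P" using rs by auto
    then have "s \<le> b" using P(3) by auto
    then have "r \<in> P" using rs ab by auto
    have "smooth_path X A r s l"
      using sm \<open>r \<in> P\<close> \<open>s \<in> P\<close> rs(3,4) by blast
    then show ?thesis
      by (rule smooth_path_cong) (use \<open>s \<le> b\<close> in auto)
  qed
  moreover have "finite (insert b' P)" "{a, b'} \<subseteq> insert b' P" "insert b' P \<subseteq> {a..b'}"
    using P ab by auto
  ultimately show ?thesis
    unfolding piecewise_smooth_path_def using cj by blast
qed

text \<open>A coordinate segment is appended with an arbitrary end time \<open>b' > b\<close>. The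
  midpoint of \<open>b\<close> and \<open>1\<close> keeps the result reachable, while
  \<open>b' = 1\<close> gives a path of the form used in the Riemannian distance.\<close>

lemma reachable_step:
  assumes xy: "reachable x y" and c: "c \<in> A" "y \<in> fst c" "z \<in> fst c"
    and U: "open U" "convex U" "U \<subseteq> snd c ` fst c" "snd c y \<in> U" "snd c z \<in> U"
  shows "reachable x z"
    and "\<exists>l. piecewise_smooth_path X A 0 1 l \<and> l 0 = x \<and> l 1 = z"
proof -
  obtain b l where l: "0 \<le> b" "b < 1" "piecewise_smooth_path X A 0 b l" "l 0 = x" "l b = y"
    using xy unfolding reachable_def by blast
  have ex: "\<exists>l. piecewise_smooth_path X A 0 b' l \<and> l 0 = x \<and> l b' = z" if b': "b < b'" for b'
  proof -
    obtain k where k: "smooth_path X A b b' k" "k b = chart_inv c (snd c y)"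
      "k b' = chart_inv c (snd c z)"
      using chart_segment_smooth_path[OF c(1) U b'] .
    have "piecewise_smooth_path X A 0 b' (\<lambda>t. if t \<le> b then l t else k t)"
      by (rule piecewise_smooth_path_extend[OF l(3,1) b' k(1)])
        (simp add: k c chart_inv_left l(5))
    then show ?thesis
      using l(1,4) k(3) b' c by (intro exI[of _ "\<lambda>t. if t \<le> b then l t else k t"])
        (auto simp: chart_inv_left)
  qed
  show "\<exists>l. piecewise_smooth_path X A 0 1 l \<and> l 0 = x \<and> l 1 = z" by (rule ex[OF l(2)])
  show "reachable x z"
    unfolding reachable_def using ex[of "(b + 1) / 2"] l(1,2)
    by (intro exI[of _ "(b + 1) / 2"]) auto
qed

text \<open>The constant path on the degenerate interval from \<open>0\<close> to \<open>0\<close>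
  works: the partition \<open>{0}\<close> has no pieces to check.\<close>

lemma reachable_refl:
  assumes "x \<in> topspace X"
  shows "reachable x x"
proof -
  have "piecewise_smooth_path X A 0 0 (\<lambda>_. x)"
    unfolding piecewise_smooth_path_def using assms by (auto intro!: exI[of _ "{0}"])
  then show ?thesis unfolding reachable_def by (intro exI[of _ 0] exI[of _ "\<lambda>_. x"]) auto
qed

text \<open>Coordinate balls are convex, so any two points of \<open>W\<close> can be joined by a
  segment within the chart.\<close>

lemma chart_ball:
  assumes "x \<in> topspace X"
  obtains c r W where "c \<in> A" "x \<in> fst c" "r > 0" "ball (snd c x) r \<subseteq> snd c ` fst c"
    "openin X W" "x \<in> W" "W \<subseteq> fst c" "snd c ` W \<subseteq> ball (snd c x) r"
proof -
  obtain c where c: "c \<in> A" "x \<in> fst c" using assms by (auto simp: topspace_charts)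
  obtain r where r: "r > 0" "ball (snd c x) r \<subseteq> snd c ` fst c"
    using chart_image_open[OF c(1)] c(2) by (meson imageI open_contains_ball)
  let ?W = "{p \<in> topspace (subtopology X (fst c)). snd c p \<in> ball (snd c x) r}"
  have "openin (subtopology X (fst c)) ?W"
    using chart_continuous[OF c(1)] by (rule openin_continuous_map_preimage) auto
  then have "openin X ?W"
    using openin_trans_full chart_open[OF c(1)] by blast
  moreover have "x \<in> ?W" "?W \<subseteq> fst c" "snd c ` ?W \<subseteq> ball (snd c x) r"
    using c r assms by auto
  ultimately show ?thesis
    using that[of c r ?W] c r by blast
qed

text \<open>The set of points reachable from \<open>x\<close> and its complement are both open, so
  connectedness leaves only the first.\<close>

lemma piecewise_smooth_path_exists:
  assumes conn: "connected_space X" and x: "x \<in> topspace X" and y: "y \<in> topspace X"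
  shows "\<exists>l. piecewise_smooth_path X A 0 1 l \<and> l 0 = x \<and> l 1 = y"
proof -
  let ?R = "{z \<in> topspace X. reachable x z}"
  let ?N = "{z \<in> topspace X. \<not> reachable x z}"
  have nbh: "\<exists>W. openin X W \<and> z \<in> W \<and> (\<forall>z'\<in>W. reachable x z' \<longleftrightarrow> reachable x z)"
    if z: "z \<in> topspace X" for z
  proof -
    obtain c r W where c: "c \<in> A" "z \<in> fst c" and r: "r > 0" "ball (snd c z) r \<subseteq> snd c ` fst c"
      and W: "openin X W" "z \<in> W" "W \<subseteq> fst c" "snd c ` W \<subseteq> ball (snd c z) r"
      using chart_ball[OF z] .
    have "reachable x z' \<longleftrightarrow> reachable x z" if z': "z' \<in> W" for z'
    proof -
      have b: "snd c z' \<in> ball (snd c z) r" "snd c z \<in> ball (snd c z) r" "z' \<in> fst c"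
        using z' W r by auto
      \<comment> \<open>One segment from \<open>z\<close> to \<open>z'\<close> and one from
        \<open>z'\<close> to \<open>z\<close> give the two directions.\<close>
      show ?thesis
        using reachable_step(1)[OF _ c(1) _ _ open_ball convex_ball r(2)] b c(2) by blast
    qed
    then show ?thesis using W by blast
  qed
  have clopen: "openin X {z \<in> topspace X. reachable x z \<longleftrightarrow> v}" for v
  proof (subst openin_subopen, intro ballI)
    fix z assume "z \<in> {z \<in> topspace X. reachable x z \<longleftrightarrow> v}"
    then have z: "z \<in> topspace X" "reachable x z \<longleftrightarrow> v" by auto
    obtain W where W: "openin X W" "z \<in> W" "\<forall>z'\<in>W. reachable x z' \<longleftrightarrow> reachable x z"
      using nbh[OF z(1)] by blast
    then have "W \<subseteq> {z \<in> topspace X. reachable x z \<longleftrightarrow> v}"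
      using z(2) openin_subset[OF W(1)] by blast
    then show "\<exists>T. openin X T \<and> z \<in> T \<and> T \<subseteq> {z \<in> topspace X. reachable x z \<longleftrightarrow> v}"
      using W by blast
  qed
  have "openin X ?R" "openin X ?N"
    using clopen[of True] clopen[of False] by simp_all
  moreover have "topspace X \<subseteq> ?R \<union> ?N" "?R \<inter> ?N = {}" "?R \<noteq> {}"
    using reachable_refl[OF x] x by auto
  ultimately have "?N = {}"
    using conn unfolding connected_space_def by meson
  then have xy: "reachable x y" using y by auto
  obtain c r W where c: "c \<in> A" "y \<in> fst c" and r: "r > 0" "ball (snd c y) r \<subseteq> snd c ` fst c"
    using chart_ball[OF y] by metis
  \<comment> \<open>Reachability gives a path to \<open>y\<close> ending before time
    \<open>1\<close>; a segment from \<open>y\<close> to itself fills the remaining time.\<close>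
  show ?thesis
    using reachable_step(2)[OF xy c(1,2,2) open_ball convex_ball r(2)] r(1) by simp
qed

end

section \<open>The Harnack inequality along paths\<close>

context riemannian begin

text \<open>The partition points closest to \<open>s\<close> on either side are consecutive, so the
  smooth piece between them contains \<open>s\<close> in its interior.\<close>

lemma piecewise_smooth_curve:
  assumes P: "finite P" "{a, b} \<subseteq> P"
    and sm: "\<forall>r\<in>P. \<forall>s\<in>P. r < s \<and> {r<..<s} \<inter> P = {} \<longrightarrow> smooth_path X A r s l"
    and s: "s \<in> {a<..<b} - P"
  shows "\<exists>I. s \<in> I \<and> smooth_curve X A I l"
proof -
  define r where "r = Max (P \<inter> {..<s})"
  define r' where "r' = Min (P \<inter> {s<..})"
  have ne: "P \<inter> {..<s} \<noteq> {}" "P \<inter> {s<..} \<noteq> {}" using P s by auto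
  have r: "r \<in> P" "r < s" "\<And>q. q \<in> P \<Longrightarrow> q < s \<Longrightarrow> q \<le> r"
    using Max_in[of "P \<inter> {..<s}"] Max_ge[of "P \<inter> {..<s}"] ne P(1) unfolding r_def by auto
  have r': "r' \<in> P" "s < r'" "\<And>q. q \<in> P \<Longrightarrow> s < q \<Longrightarrow> r' \<le> q"
    using Min_in[of "P \<inter> {s<..}"] Min_le[of "P \<inter> {s<..}"] ne P(1) unfolding r'_def by auto
  have "q \<notin> P" if "q \<in> {r<..<r'}" for q
    using that r(3)[of q] r'(3)[of q] s by (cases q s rule: linorder_cases) auto
  then have "{r<..<r'} \<inter> P = {}" by blast
  then have "smooth_path X A r r' l"
    using sm r r' by (meson less_trans)
  then show ?thesis
    using smooth_path_curve r(2) r'(2) by (intro exI[of _ "{r<..<r'}"]) auto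
qed

text \<open>Induction on the number of partition points before \<open>b\<close>: the last piece is
  split off, and on it the speed agrees with a continuous function except at its ends.\<close>

lemma piecewise_smooth_path_speed_integrable:
  assumes P: "finite P" "a \<in> P"
    and sm: "\<forall>r\<in>P. \<forall>s\<in>P. r < s \<and> {r<..<s} \<inter> P = {} \<longrightarrow> smooth_path X A r s l"
    and b: "b \<in> P" "a \<le> b"
  shows "(\<lambda>t. tangent_norm g (l t) (curve_velocity A l t)) integrable_on {a..b}"
  using b
proof (induction "card (P \<inter> {..<b})" arbitrary: b rule: less_induct)
  case less
  let ?v = "\<lambda>t. tangent_norm g (l t) (curve_velocity A l t)"
  show ?case
  proof (cases "a = b")
    case True
    then show ?thesis using integrable_on_refl[of ?v a] by simp
  next
    case False
    define r where "r = Max (P \<inter> {..<b})"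
    have ne: "P \<inter> {..<b} \<noteq> {}" using P less.prems False by auto
    have r: "r \<in> P" "r < b" "\<And>q. q \<in> P \<Longrightarrow> q < b \<Longrightarrow> q \<le> r"
      using Max_in[of "P \<inter> {..<b}"] Max_ge[of "P \<inter> {..<b}"] ne P(1) unfolding r_def by auto
    have ar: "a \<le> r" using r(3)[OF P(2)] less.prems False by simp
    have "card (P \<inter> {..<r}) < card (P \<inter> {..<b})"
      using P(1) r by (intro psubset_card_mono) auto
    then have 1: "?v integrable_on {a..r}" using less.hyps r(1) ar by blast
    have "{r<..<b} \<inter> P = {}" using r(3) by force
    then have "smooth_path X A r b l" using sm r less.prems by blast
    then obtain q where q: "continuous_on {r..b} q" "\<And>t. t \<in> {r<..<b} \<Longrightarrow> ?v t = q t"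
      using smooth_path_speed by blast
    have 2: "?v integrable_on {r..b}"
    proof (rule integrable_spike_finite[of "{r, b}"])
      show "q integrable_on {r..b}" by (rule integrable_continuous_real[OF q(1)])
    qed (use q(2) in auto)
    show ?thesis by (rule Henstock_Kurzweil_Integration.integrable_combine[OF ar less_imp_le[OF r(2)] 1 2])
  qed
qed

lemma log_solution_continuous:
  fixes \<tau> :: "real \<Rightarrow> real"
  assumes u: "smooth_spacetime A u" and pos: "\<forall>x\<in>topspace X. \<forall>t>0. u x t > 0"
    and l: "continuous_map (top_of_set T) X l"
    and \<tau>: "continuous_on T \<tau>" "\<And>s. s \<in> T \<Longrightarrow> \<tau> s > 0"
  shows "continuous_on T (\<lambda>s. ln (u (l s) (\<tau> s)))"
proof -
  have "continuous (at s within T) (\<lambda>s. ln (u (l s) (\<tau> s)))" if s: "s \<in> T" for s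
  proof -
    have ls: "l r \<in> topspace X" if "r \<in> T" for r
      using continuous_map_image_subset_topspace[OF l] that by auto
    obtain c where c: "c \<in> A" "l s \<in> fst c"
      using ls[OF s] by (auto simp: topspace_charts)
    let ?S = "T \<inter> l -` fst c"
    obtain W where W: "open W" "?S = T \<inter> W"
      using curve_chart_openin[OF l chart_open[OF c(1)]] by (auto simp: openin_open)
    \<comment> \<open>The part of \<open>T\<close> mapped into the chart is relatively open, so
      restricting to it does not change the limit at \<open>s\<close>.\<close>
    have at: "at s within T = at s within ?S"
      by (rule at_within_nhd[of s W]) (use W s c(2) in auto)
    let ?U = "\<lambda>z. u (chart_inv c (fst z)) (snd z)"
    have U: "continuous_on ((snd c ` fst c) \<times> {0<..}) ?U"
      using u c(1) smooth_on_continuous unfolding smooth_spacetime_def by blast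
    have "continuous_on ?S (\<lambda>r. ((snd c \<circ> l) r, \<tau> r))"
      by (intro continuous_on_Pair curve_chart_continuous[OF l c(1)] continuous_on_subset[OF \<tau>(1)]) auto
    then have "continuous_on ?S (\<lambda>r. ?U ((snd c \<circ> l) r, \<tau> r))"
      by (rule continuous_on_compose2[OF U]) (use \<tau>(2) in auto)
    then have "continuous_on ?S (\<lambda>r. u (l r) (\<tau> r))"
      by (rule continuous_on_eq) (simp add: chart_inv_left[OF c(1)])
    then have "continuous_on ?S (\<lambda>r. ln (u (l r) (\<tau> r)))"
      by (rule continuous_on_ln) (use pos \<tau>(2) ls in force)
    then show ?thesis
      using s c(2) at by (simp add: continuous_on_eq_continuous_within)
  qed
  then show ?thesis by (simp add: continuous_on_eq_continuous_within)
qed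

text \<open>A common form for both claims. The clock \<tau> is free, and the lower bound enters
  through an integrable minorant \<open>h\<close>, so only \<open>h\<close> has to be
  integrated.\<close>

lemma harnack_along_curve:
  fixes \<tau>' h :: "real \<Rightarrow> real"
  assumes u: "smooth_spacetime A u" and pos: "\<forall>x\<in>topspace X. \<forall>t>0. u x t > 0"
    and coeff: "\<forall>t>0. \<gamma> t > 0" "\<forall>t>0. \<alpha> t > 0"
    and harnack: "\<forall>x\<in>topspace X. \<forall>t>0.
           \<gamma> t * ((tangent_norm g x (gradient A g (\<lambda>y. u y t) x))\<^sup>2 / (u x t)\<^sup>2)
           - \<alpha> t * (deriv (\<lambda>s. u x s) t / u x t) - \<phi> t \<le> 0"
    and ab: "a \<le> b" and l: "continuous_map (top_of_set {a..b}) X l" and P: "finite P"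
    and sm: "\<And>s. s \<in> {a<..<b} - P \<Longrightarrow> \<exists>I. s \<in> I \<and> smooth_curve X A I l"
    and \<tau>: "continuous_on {a..b} \<tau>" "\<And>s. s \<in> {a..b} \<Longrightarrow> \<tau> s > 0"
      "\<And>s. s \<in> {a<..<b} - P \<Longrightarrow> (\<tau> has_real_derivative \<tau>' s) (at s)"
      "\<And>s. s \<in> {a<..<b} - P \<Longrightarrow> \<tau>' s > 0"
    and h: "h integrable_on {a..b}"
      "\<And>s. s \<in> {a<..<b} - P \<Longrightarrow> h s \<le> - (\<phi> (\<tau> s) / \<alpha> (\<tau> s)) * \<tau>' s
         - \<alpha> (\<tau> s) / (4 * \<gamma> (\<tau> s)) * ((tangent_norm g (l s) (curve_velocity A l s))\<^sup>2 / \<tau>' s)"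
  shows "integral {a..b} h \<le> ln (u (l b) (\<tau> b)) - ln (u (l a) (\<tau> a))"
proof -
  let ?F = "\<lambda>s. ln (u (l s) (\<tau> s))"
  define F' where "F' s = (g (l s) (gradient A g (\<lambda>y. u y (\<tau> s)) (l s)) (curve_velocity A l s)
     + \<tau>' s * deriv (u (l s)) (\<tau> s)) / u (l s) (\<tau> s)" for s
  have D: "(?F has_real_derivative F' s) (at s)" and le: "h s \<le> F' s" if s: "s \<in> {a<..<b} - P" for s
  proof -
    obtain I where I: "s \<in> I" "smooth_curve X A I l" using sm[OF s] by blast
    have ts: "\<tau> s > 0" using \<tau>(2) s by auto
    note ld = log_solution_derivative[OF u pos I(2,1) \<tau>(3)[OF s] ts]
    show "(?F has_real_derivative F' s) (at s)" unfolding F'_def by (rule ld(2))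
    let ?p = "l s" and ?t = "\<tau> s"
    let ?\<xi> = "curve_velocity A l s" and ?\<eta> = "gradient A g (\<lambda>y. u y (\<tau> s)) (l s)"
    define w where "w = u ?p ?t"
    \<comment> \<open>\<open>k\<close> is the coefficient of the squared gradient of
      \<open>ln u\<close> once the Harnack inequality is multiplied by
      \<open>\<tau>' / \<alpha>\<close>.\<close>
    define k where "k = \<tau>' s * \<gamma> ?t / \<alpha> ?t"
    have p: "?p \<in> topspace X" using smooth_curve_topspace[OF I(2,1)] .
    have w: "w > 0" using pos p ts by (simp add: w_def)
    have ag: "\<alpha> ?t > 0" "\<gamma> ?t > 0" "\<tau>' s > 0" using coeff ts \<tau>(4)[OF s] by auto
    have k: "k > 0" using ag by (simp add: k_def)
    have \<xi>: "?\<xi> \<in> tangent_space A ?p" by (rule curve_velocity_tangent[OF I(2,1)])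
    have H: "\<gamma> ?t * (g ?p ?\<eta> ?\<eta> / w\<^sup>2) - \<alpha> ?t * (deriv (u ?p) ?t / w) - \<phi> ?t \<le> 0"
      using harnack[rule_format, OF p ts] unfolding tangent_norm_square[OF p ld(1)] w_def .
    have "0 \<le> (\<tau>' s / \<alpha> ?t) *
      - (\<gamma> ?t * (g ?p ?\<eta> ?\<eta> / w\<^sup>2) - \<alpha> ?t * (deriv (u ?p) ?t / w) - \<phi> ?t)"
      using H ag by (intro mult_nonneg_nonneg) auto
    then have 1: "\<tau>' s * deriv (u ?p) ?t / w \<ge> k * g ?p ?\<eta> ?\<eta> / w\<^sup>2 - \<phi> ?t / \<alpha> ?t * \<tau>' s"
      using ag w by (simp add: k_def field_simps)
    \<comment> \<open>With weight \<open>k / w\<close>, division by \<open>w\<close> afterwards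
      produces precisely the gradient term of the previous bound, so the two cancel when
      added.\<close>
    have "0 \<le> (k / w) * g ?p ?\<eta> ?\<eta> + g ?p ?\<eta> ?\<xi> + g ?p ?\<xi> ?\<xi> / (4 * (k / w))"
      by (rule metric_weighted_young[OF p \<xi> ld(1)]) (use k w in simp)
    then have "0 \<le> ((k / w) * g ?p ?\<eta> ?\<eta> + g ?p ?\<eta> ?\<xi> + g ?p ?\<xi> ?\<xi> / (4 * (k / w))) / w"
      using w by (intro divide_nonneg_pos)
    also have "\<dots> = k * g ?p ?\<eta> ?\<eta> / w\<^sup>2 + g ?p ?\<eta> ?\<xi> / w + g ?p ?\<xi> ?\<xi> / (4 * k)"
      using w k by (simp add: field_simps power2_eq_square)
    finally have 2: "0 \<le> k * g ?p ?\<eta> ?\<eta> / w\<^sup>2 + g ?p ?\<eta> ?\<xi> / w + g ?p ?\<xi> ?\<xi> / (4 * k)" .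
    have 3: "\<alpha> ?t / (4 * \<gamma> ?t) * ((tangent_norm g ?p ?\<xi>)\<^sup>2 / \<tau>' s) = g ?p ?\<xi> ?\<xi> / (4 * k)"
      using tangent_norm_square[OF p \<xi>] ag by (simp add: k_def field_simps)
    have "F' s = g ?p ?\<eta> ?\<xi> / w + \<tau>' s * deriv (u ?p) ?t / w"
      by (simp add: F'_def w_def add_divide_distrib)
    then show "h s \<le> F' s"
      using h(2)[OF s] 1 2 3 by linarith
  qed
  have F': "(F' has_integral (?F b - ?F a)) {a..b}"
  \<comment> \<open>Continuity on the closed interval together with a derivative off the finite set
    \<open>P\<close> is what this form of the theorem asks for.\<close>
  proof (rule fundamental_theorem_of_calculus_interior_strong[OF P ab])
    show "continuous_on {a..b} ?F" by (rule log_solution_continuous[OF u pos l \<tau>(1,2)])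
  qed (use D in \<open>simp add: has_real_derivative_iff_has_vector_derivative\<close>)
  \<comment> \<open>\<open>h\<close> is compared with the derivative only off finitely many points;
    replacing it by \<open>F'\<close> there makes the comparison valid everywhere and keeps the
    integral.\<close>
  define h' where "h' s = (if s \<in> {a<..<b} - P then h s else F' s)" for s
  have fin: "finite (P \<union> {a, b})" using P by simp
  have "(h' has_integral integral {a..b} h) {a..b}"
    by (rule has_integral_spike_finite[OF fin _ integrable_integral[OF h(1)]]) (auto simp: h'_def)
  then show ?thesis
    by (rule has_integral_le[OF _ F']) (use le in \<open>auto simp: h'_def\<close>)
qed

text \<open>The clock is the time of the path itself, with rate \<open>1\<close>, and
  \<open>h\<close> is the integrand of the claim.\<close>

lemma harnack_smooth_path:
  assumes u: "smooth_spacetime A u" and pos: "\<forall>x\<in>topspace X. \<forall>t>0. u x t > 0"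
    and coeff: "\<forall>t>0. \<gamma> t > 0" "\<forall>t>0. \<alpha> t > 0"
    and cont: "continuous_on {0<..} \<gamma>" "continuous_on {0<..} \<alpha>" "continuous_on {0<..} \<phi>"
    and harnack: "\<forall>x\<in>topspace X. \<forall>t>0.
           \<gamma> t * ((tangent_norm g x (gradient A g (\<lambda>y. u y t) x))\<^sup>2 / (u x t)\<^sup>2)
           - \<alpha> t * (deriv (\<lambda>s. u x s) t / u x t) - \<phi> t \<le> 0"
    and t: "0 < t\<^sub>1" "t\<^sub>1 < t\<^sub>2" and l: "smooth_path X A t\<^sub>1 t\<^sub>2 l"
  shows "integral {t\<^sub>1..t\<^sub>2} (\<lambda>t. - \<phi> t / \<alpha> t
            - \<alpha> t / (4 * \<gamma> t) * (tangent_norm g (l t) (velocity A t\<^sub>1 t\<^sub>2 l t))\<^sup>2)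
         \<le> ln (u (l t\<^sub>2) t\<^sub>2) - ln (u (l t\<^sub>1) t\<^sub>1)" (is "integral _ ?h \<le> _")
proof (rule harnack_along_curve[OF u pos coeff harnack, where \<tau> = "\<lambda>t. t" and \<tau>' = "\<lambda>_. 1" and P = "{}"])
  show "\<exists>I. s \<in> I \<and> smooth_curve X A I l" if "s \<in> {t\<^sub>1<..<t\<^sub>2} - {}" for s
    using smooth_path_curve[OF l] that by blast
  obtain q where q: "continuous_on {t\<^sub>1..t\<^sub>2} q"
    "\<And>t. t \<in> {t\<^sub>1<..<t\<^sub>2} \<Longrightarrow> tangent_norm g (l t) (curve_velocity A l t) = q t"
    using smooth_path_speed[OF l] by blast
  have sub: "{t\<^sub>1..t\<^sub>2} \<subseteq> {0<..}" using t by auto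
  have nz: "\<alpha> t \<noteq> 0" "\<gamma> t \<noteq> 0" if "t \<in> {t\<^sub>1..t\<^sub>2}" for t
    using coeff[rule_format, of t] that t by auto
  show "?h integrable_on {t\<^sub>1..t\<^sub>2}"
  \<comment> \<open>Inside the interval the one-sided \<open>velocity\<close> is the two-sided one,
    so the integrand differs from a continuous function at most at the end points.\<close>
  proof (rule integrable_spike_finite[of "{t\<^sub>1, t\<^sub>2}"])
    show "(\<lambda>t. - \<phi> t / \<alpha> t - \<alpha> t / (4 * \<gamma> t) * (q t)\<^sup>2) integrable_on {t\<^sub>1..t\<^sub>2}"
      using nz by (intro integrable_continuous_real continuous_intros q(1)
          continuous_on_subset[OF cont(1) sub] continuous_on_subset[OF cont(2) sub]
          continuous_on_subset[OF cont(3) sub]) auto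
    show "?h s = - \<phi> s / \<alpha> s - \<alpha> s / (4 * \<gamma> s) * (q s)\<^sup>2" if "s \<in> {t\<^sub>1..t\<^sub>2} - {t\<^sub>1, t\<^sub>2}" for s
    proof -
      have s: "s \<in> {t\<^sub>1<..<t\<^sub>2}" using that by auto
      show ?thesis by (simp only: velocity_interior[OF s] q(2)[OF s])
    qed
  qed simp
  show "?h s \<le> - (\<phi> s / \<alpha> s) * 1
      - \<alpha> s / (4 * \<gamma> s) * ((tangent_norm g (l s) (curve_velocity A l s))\<^sup>2 / 1)"
    if "s \<in> {t\<^sub>1<..<t\<^sub>2} - {}" for s
    using that velocity_interior[of s t\<^sub>1 t\<^sub>2 A l] by simp
qed (use t smooth_path_continuous[OF l] in \<open>auto intro!: derivative_eq_intros continuous_intros\<close>)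

text \<open>The clock is adapted to the path instead of the path to the clock, so no constant speed
  parametrization has to be constructed. The summand \<epsilon> keeps the clock running where the
  path rests.\<close>

lemma harnack_piecewise_smooth_path:
  assumes u: "smooth_spacetime A u" and pos: "\<forall>x\<in>topspace X. \<forall>t>0. u x t > 0"
    and coeff: "\<gamma>\<^sub>0 > 0" "\<alpha>\<^sub>0 > 0" and cont: "continuous_on {0<..} \<phi>"
    and harnack: "\<forall>x\<in>topspace X. \<forall>t>0.
           \<gamma>\<^sub>0 * ((tangent_norm g x (gradient A g (\<lambda>y. u y t) x))\<^sup>2 / (u x t)\<^sup>2)
           - \<alpha>\<^sub>0 * (deriv (\<lambda>s. u x s) t / u x t) - \<phi> t \<le> 0"
    and t: "0 < t\<^sub>1" "t\<^sub>1 < t\<^sub>2" and l: "piecewise_smooth_path X A 0 1 l" and \<epsilon>: "\<epsilon> > 0"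
  defines "L \<equiv> curve_length A g 0 1 l"
  shows "L \<ge> 0"
    and "- integral {t\<^sub>1..t\<^sub>2} (\<lambda>t. \<phi> t / \<alpha>\<^sub>0) - \<alpha>\<^sub>0 / (4 * \<gamma>\<^sub>0) * (L * (L + \<epsilon>) / (t\<^sub>2 - t\<^sub>1))
         \<le> ln (u (l 1) t\<^sub>2) - ln (u (l 0) t\<^sub>1)"
proof -
  obtain P where P: "finite P" "{0, 1} \<subseteq> P" "P \<subseteq> {0..1}"
    and sm: "\<forall>r\<in>P. \<forall>s\<in>P. r < s \<and> {r<..<s} \<inter> P = {} \<longrightarrow> smooth_path X A r s l"
    using l unfolding piecewise_smooth_path_def by blast
  have cl: "continuous_map (top_of_set {0..1}) X l"
    using l by (simp add: piecewise_smooth_path_def)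
  let ?G = "{0<..<1} - P"
  have oG: "open ?G" using P(1) by (simp add: open_Diff finite_imp_closed)
  let ?\<sigma> = "\<lambda>s. tangent_norm g (l s) (curve_velocity A l s)"
  \<comment> \<open>The speed with value \<open>0\<close> at corners and end points, where a
    two-sided velocity need not exist; this makes it nonnegative everywhere without changing its
    integral.\<close>
  define v where "v s = (if s \<in> ?G then ?\<sigma> s else 0)" for s
  have curve: "\<exists>I. s \<in> I \<and> smooth_curve X A I l" if "s \<in> ?G" for s
    using piecewise_smooth_curve[OF P(1,2) sm that] .
  have v0: "v s \<ge> 0" for s
  proof (cases "s \<in> ?G")
    case True
    then obtain I where I: "s \<in> I" "smooth_curve X A I l" using curve by blast
    then have "?\<sigma> s \<ge> 0"
      unfolding tangent_norm_def
      using metric_nonneg[OF smooth_curve_topspace[OF I(2,1)] curve_velocity_tangent[OF I(2,1)]]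
      by simp
    then show ?thesis by (simp add: v_def)
  qed (auto simp: v_def)
  have vint: "v integrable_on {0..1}"
  proof (rule integrable_spike_finite[OF P(1)])
    show "?\<sigma> integrable_on {0..1}"
      by (rule piecewise_smooth_path_speed_integrable[OF P(1) _ sm]) (use P in auto)
    show "v s = ?\<sigma> s" if "s \<in> {0..1} - P" for s
    proof -
      have "s \<in> ?G" using that P(2) by (cases "s = 0 \<or> s = 1") auto
      then show ?thesis by (simp add: v_def)
    qed
  qed
  have vL: "(v has_integral L) {0..1}"
  proof -
    have "integral {0..1} (\<lambda>t. tangent_norm g (l t) (velocity A 0 1 l t)) = integral {0..1} v"
    proof (rule integral_spike[of P])
      show "v s = tangent_norm g (l s) (velocity A 0 1 l s)" if "s \<in> {0..1} - P" for s
      proof -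
        have "s \<in> ?G" using that P(2) by (cases "s = 0 \<or> s = 1") auto
        then show ?thesis using velocity_interior[of s 0 1 A l] by (simp add: v_def)
      qed
    qed (simp add: P(1) negligible_finite)
    then show ?thesis
      using integrable_integral[OF vint] by (simp add: L_def curve_length_def)
  qed
  show L0: "L \<ge> 0" by (rule has_integral_nonneg[OF vL]) (rule v0)
  have vcont: "isCont v s" if s: "s \<in> ?G" for s
  proof -
    obtain I where I: "s \<in> I" "smooth_curve X A I l" using curve[OF s] by blast
    have oI: "open (I \<inter> ?G)" using I(2) oG by (auto simp: smooth_curve_def)
    have "continuous_on (I \<inter> ?G) ?\<sigma>"
      by (rule continuous_on_subset[OF curve_speed_continuous[OF I(2)]]) auto
    then have "continuous_on (I \<inter> ?G) v"
      by (rule continuous_on_eq) (auto simp: v_def)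
    then show ?thesis
      using oI I(1) s continuous_on_eq_continuous_at[OF oI] by blast
  qed
  let ?W = "\<lambda>s. v s + \<epsilon>"
  have WL: "(?W has_integral (L + \<epsilon>)) {0..1}"
    using has_integral_add[OF vL has_integral_const_real[of \<epsilon> 0 1]] by simp
  have Wint: "?W integrable_on {0..1}" using WL by blast
  have Wsub: "?W integrable_on {0..s}" if "s \<in> {0..1}" for s
    by (rule integrable_on_subinterval[OF Wint]) (use that in auto)
  define T where "T = t\<^sub>2 - t\<^sub>1"
  \<comment> \<open>The normalization that makes the clock reach \<open>t\<^sub>2\<close> at
    parameter \<open>1\<close>.\<close>
  define K where "K = T / (L + \<epsilon>)"
  have T: "T > 0" using t by (simp add: T_def)
  have K: "K > 0" using T L0 \<epsilon> by (simp add: K_def)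
  \<comment> \<open>Time is run proportionally to the arclength of \<open>l\<close>, up to the regularization \<open>\<epsilon>\<close>.\<close>
  define \<tau> where "\<tau> s = t\<^sub>1 + K * integral {0..s} ?W" for s
  define \<tau>' where "\<tau>' s = K * ?W s" for s
  have \<tau>0: "\<tau> 0 = t\<^sub>1" by (simp add: \<tau>_def)
  have \<tau>1: "\<tau> 1 = t\<^sub>2"
    using integral_unique[OF WL] L0 \<epsilon> by (simp add: \<tau>_def K_def T_def)
  have \<tau>r: "\<tau> s \<in> {t\<^sub>1..t\<^sub>2}" if s: "s \<in> {0..1}" for s
  proof -
    have W0: "?W r \<ge> 0" for r using v0[of r] \<epsilon> by simp
    have "0 \<le> integral {0..s} ?W" using W0 by (intro integral_nonneg Wsub s)
    moreover have "integral {0..s} ?W \<le> integral {0..1} ?W"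
      by (rule integral_subset_le) (use s W0 Wsub[OF s] Wint in auto)
    ultimately have "\<tau> s \<ge> t\<^sub>1" "\<tau> s \<le> \<tau> 1"
      using K by (auto simp: \<tau>_def intro!: mult_left_mono)
    then show ?thesis using \<tau>1 by simp
  qed
  have \<tau>c: "continuous_on {0..1} \<tau>"
    unfolding \<tau>_def by (intro continuous_intros indefinite_integral_continuous_1[OF Wint])
  have \<tau>d: "(\<tau> has_real_derivative \<tau>' s) (at s)" if s: "s \<in> ?G" for s
  proof -
    have "at s within ({0..1} - {}) = at s"
      using s by (simp add: at_within_Icc_at)
    moreover have "continuous (at s) ?W"
      using vcont[OF s] by (intro continuous_intros)
    ultimately have "((\<lambda>r. integral {0..r} ?W) has_vector_derivative ?W s) (at s)"
      using integral_has_vector_derivative_continuous_at[OF Wint, of s "{}"] s by simp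
    then have "((\<lambda>r. integral {0..r} ?W) has_real_derivative ?W s) (at s)"
      by (simp add: has_real_derivative_iff_has_vector_derivative)
    then show ?thesis
      unfolding \<tau>_def \<tau>'_def by (auto intro!: derivative_eq_intros)
  qed
  \<comment> \<open>An antiderivative of \<phi>. Starting at \<open>t\<^sub>1 / 2\<close> and
    working up to \<open>t\<^sub>2 + 1\<close> puts both end times in the interior, where its
    derivative is two-sided, and stays within positive times.\<close>
  let ?\<Phi> = "\<lambda>t. integral {t\<^sub>1 / 2..t} \<phi>"
  have c\<phi>: "continuous_on {t\<^sub>1 / 2..t\<^sub>2 + 1} \<phi>"
    by (rule continuous_on_subset[OF cont]) (use t in auto)
  have \<Phi>d: "(?\<Phi> has_real_derivative \<phi> r) (at r)" if "r \<in> {t\<^sub>1..t\<^sub>2}" for r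
  proof -
    have "(?\<Phi> has_vector_derivative \<phi> r) (at r within {t\<^sub>1 / 2..t\<^sub>2 + 1})"
      by (rule integral_has_vector_derivative[OF c\<phi>]) (use that t in auto)
    moreover have "at r within {t\<^sub>1 / 2..t\<^sub>2 + 1} = at r"
      using that t by (simp add: at_within_Icc_at)
    ultimately show ?thesis by (simp add: has_real_derivative_iff_has_vector_derivative)
  qed
  \<comment> \<open>Substitution along the clock: the fundamental theorem is applied to the
    antiderivative composed with \<tau>, which is differentiable off \<open>P\<close>.\<close>
  have "((\<lambda>s. \<phi> (\<tau> s) * \<tau>' s) has_integral (?\<Phi> (\<tau> 1) - ?\<Phi> (\<tau> 0))) {0..1}"
  proof (rule fundamental_theorem_of_calculus_interior_strong[OF P(1), where f = "\<lambda>s. ?\<Phi> (\<tau> s)"])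
    show "((\<lambda>s. ?\<Phi> (\<tau> s)) has_vector_derivative \<phi> (\<tau> s) * \<tau>' s) (at s)" if s: "s \<in> ?G" for s
      using DERIV_chain2[OF \<Phi>d \<tau>d[OF s]] \<tau>r[of s] s
      by (simp add: has_real_derivative_iff_has_vector_derivative)
    show "continuous_on {0..1} (\<lambda>s. ?\<Phi> (\<tau> s))"
    proof (rule continuous_on_compose2[OF _ \<tau>c])
      show "continuous_on {t\<^sub>1..t\<^sub>2} ?\<Phi>"
        using \<Phi>d DERIV_isCont continuous_at_imp_continuous_on by blast
    qed (use \<tau>r in blast)
  qed simp
  moreover have "?\<Phi> t\<^sub>2 - ?\<Phi> t\<^sub>1 = integral {t\<^sub>1..t\<^sub>2} \<phi>"
  proof -
    have "\<phi> integrable_on {t\<^sub>1 / 2..t\<^sub>2}"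
      by (rule integrable_continuous_real[OF continuous_on_subset[OF c\<phi>]]) auto
    then show ?thesis
      using Henstock_Kurzweil_Integration.integral_combine[of "t\<^sub>1 / 2" t\<^sub>1 t\<^sub>2 \<phi>] t by simp
  qed
  ultimately have \<phi>I: "((\<lambda>s. \<phi> (\<tau> s) * \<tau>' s) has_integral integral {t\<^sub>1..t\<^sub>2} \<phi>) {0..1}"
    by (simp add: \<tau>0 \<tau>1)
  \<comment> \<open>\<open>C * v s\<close> will dominate the quadratic speed term; being linear in
    the speed, it integrates to \<open>C * L\<close>.\<close>
  define C where "C = \<alpha>\<^sub>0 / (4 * \<gamma>\<^sub>0) * ((L + \<epsilon>) / T)"
  let ?h = "\<lambda>s. - (1 / \<alpha>\<^sub>0) * (\<phi> (\<tau> s) * \<tau>' s) - C * v s"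
  have hI: "(?h has_integral (- (1 / \<alpha>\<^sub>0) * integral {t\<^sub>1..t\<^sub>2} \<phi> - C * L)) {0..1}"
    by (intro has_integral_diff has_integral_mult_right \<phi>I vL)
  have "integral {0..1} ?h \<le> ln (u (l 1) (\<tau> 1)) - ln (u (l 0) (\<tau> 0))"
  proof (rule harnack_along_curve[OF u pos _ _ _ _ cl P(1) curve \<tau>c _ \<tau>d,
        where \<alpha> = "\<lambda>_. \<alpha>\<^sub>0" and \<gamma> = "\<lambda>_. \<gamma>\<^sub>0" and \<phi> = \<phi>])
    show "?h integrable_on {0..1}" using hI by blast
    show tpos: "\<tau>' s > 0" if "s \<in> ?G" for s
      using K v0[of s] \<epsilon> by (simp add: \<tau>'_def add_nonneg_pos)
    show "?h s \<le> - (\<phi> (\<tau> s) / \<alpha>\<^sub>0) * \<tau>' s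
      - \<alpha>\<^sub>0 / (4 * \<gamma>\<^sub>0) * ((?\<sigma> s)\<^sup>2 / \<tau>' s)" if s: "s \<in> ?G" for s
    proof -
      have vs: "?\<sigma> s = v s" using s by (simp add: v_def)
      have "v s * v s \<le> v s * (v s + \<epsilon>)" using v0[of s] \<epsilon> by (intro mult_left_mono) auto
      then have "(v s)\<^sup>2 / (v s + \<epsilon>) \<le> v s"
        using v0[of s] \<epsilon> by (simp add: power2_eq_square pos_divide_le_eq)
      then have "(v s)\<^sup>2 / (v s + \<epsilon>) * ((L + \<epsilon>) / T) \<le> v s * ((L + \<epsilon>) / T)"
        using L0 \<epsilon> T by (intro mult_right_mono) auto
      \<comment> \<open>The clock rate is \<open>v s + \<epsilon>\<close> times \<open>K\<close>,
        and \<open>1 / K\<close> is \<open>(L + \<epsilon>) / T\<close>.\<close>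
      moreover have "(v s)\<^sup>2 / \<tau>' s = (v s)\<^sup>2 / (v s + \<epsilon>) * ((L + \<epsilon>) / T)"
        by (simp add: \<tau>'_def K_def)
      ultimately have "\<alpha>\<^sub>0 / (4 * \<gamma>\<^sub>0) * ((v s)\<^sup>2 / \<tau>' s) \<le> \<alpha>\<^sub>0 / (4 * \<gamma>\<^sub>0) * (v s * ((L + \<epsilon>) / T))"
        using coeff by (intro mult_left_mono) auto
      then show ?thesis by (simp add: C_def vs mult_ac)
    qed
  qed (use coeff harnack \<tau>r t in \<open>force+\<close>)
  moreover have "integral {t\<^sub>1..t\<^sub>2} (\<lambda>t. \<phi> t / \<alpha>\<^sub>0) = (1 / \<alpha>\<^sub>0) * integral {t\<^sub>1..t\<^sub>2} \<phi>"
    by simp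
  moreover have "C * L = \<alpha>\<^sub>0 / (4 * \<gamma>\<^sub>0) * (L * (L + \<epsilon>) / (t\<^sub>2 - t\<^sub>1))"
    by (simp add: C_def T_def)
  ultimately show "- integral {t\<^sub>1..t\<^sub>2} (\<lambda>t. \<phi> t / \<alpha>\<^sub>0)
      - \<alpha>\<^sub>0 / (4 * \<gamma>\<^sub>0) * (L * (L + \<epsilon>) / (t\<^sub>2 - t\<^sub>1)) \<le> ln (u (l 1) t\<^sub>2) - ln (u (l 0) t\<^sub>1)"
    using integral_unique[OF hI] by (simp add: \<tau>0 \<tau>1)
qed

end

theorem theorem2p7:
  fixes X :: "'a topology" and A :: "('a, 'n::finite) chart set"
    and g :: "('a, 'n) metric_tensor" and V :: "'a \<Rightarrow> ('a, 'n) tangent"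
    and N :: nat and p a :: "nat \<Rightarrow> real"
    and u f :: "'a \<Rightarrow> real \<Rightarrow> real"
    and \<gamma> \<alpha> \<phi> :: "real \<Rightarrow> real"
    and x\<^sub>1 x\<^sub>2 :: 'a and t\<^sub>1 t\<^sub>2 :: real
  assumes "complete_riemannian_manifold X A g"
    and "C1_vector_field X A V"
    and "strict_mono_on {1..N} p" and "\<forall>i\<in>{1..N}. p i \<le> 1"
    and "\<forall>i\<in>{1..N}. a i \<ge> 0"
    and "smooth_spacetime A u"
    and "\<forall>x\<in>topspace X. \<forall>t>0. u x t > 0"
    and "\<forall>x\<in>topspace X. \<forall>t>0.
           deriv (\<lambda>s. u x s) t =
             drift_laplacian A g V (\<lambda>y. u y t) x + (\<Sum>i=1..N. a i * u x t powr p i)"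
    and "f = (\<lambda>x t. ln (u x t))"
    and "Ck_on 1 {0<..} \<gamma>" and "Ck_on 1 {0<..} \<alpha>" and "Ck_on 1 {0<..} \<phi>"
    and "\<forall>t>0. \<gamma> t > 0" and "\<forall>t>0. \<alpha> t > 0"
    and "\<forall>x\<in>topspace X. \<forall>t>0.
           \<gamma> t * ((tangent_norm g x (gradient A g (\<lambda>y. u y t) x))\<^sup>2 / (u x t)\<^sup>2)
           - \<alpha> t * (deriv (\<lambda>s. u x s) t / u x t)
           + \<alpha> t * (\<Sum>i=1..N. a i * u x t powr (p i - 1)) - \<phi> t \<le> 0"
    and "x\<^sub>1 \<in> topspace X" and "x\<^sub>2 \<in> topspace X" and "0 < t\<^sub>1" and "t\<^sub>1 < t\<^sub>2"
  shows "(\<forall>l. smooth_path X A t\<^sub>1 t\<^sub>2 l \<and> l t\<^sub>1 = x\<^sub>1 \<and> l t\<^sub>2 = x\<^sub>2 \<longrightarrow>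
            f x\<^sub>2 t\<^sub>2 - f x\<^sub>1 t\<^sub>1 \<ge>
              integral {t\<^sub>1..t\<^sub>2} (\<lambda>t. - \<phi> t / \<alpha> t
                - \<alpha> t / (4 * \<gamma> t) * (tangent_norm g (l t) (velocity A t\<^sub>1 t\<^sub>2 l t))\<^sup>2)) \<and>
         (\<forall>\<alpha>\<^sub>0 \<gamma>\<^sub>0. (\<forall>t>0. \<alpha> t = \<alpha>\<^sub>0 \<and> \<gamma> t = \<gamma>\<^sub>0) \<longrightarrow>
            f x\<^sub>2 t\<^sub>2 - f x\<^sub>1 t\<^sub>1 \<ge>
              - integral {t\<^sub>1..t\<^sub>2} (\<lambda>t. \<phi> t / \<alpha>\<^sub>0)
              - \<alpha>\<^sub>0 / (4 * \<gamma>\<^sub>0) * ((riemannian_dist X A g x\<^sub>1 x\<^sub>2)\<^sup>2 / (t\<^sub>2 - t\<^sub>1)))"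
proof -
  interpret riemannian X A g
    using assms(1) by unfold_locales (simp_all add: complete_riemannian_manifold_def)
  have conn: "connected_space X"
    using assms(1) by (simp add: complete_riemannian_manifold_def)
  have harnack: "\<forall>x\<in>topspace X. \<forall>t>0.
      \<gamma> t * ((tangent_norm g x (gradient A g (\<lambda>y. u y t) x))\<^sup>2 / (u x t)\<^sup>2)
        - \<alpha> t * (deriv (\<lambda>s. u x s) t / u x t) - \<phi> t \<le> 0"
  proof (intro ballI allI impI)
    fix x and t :: real
    assume x: "x \<in> topspace X" and t: "t > 0"
    \<comment> \<open>The reaction term is nonnegative because every \<open>a i\<close> is, so the
      Harnack inequality remains true when it is omitted.\<close>
    have "0 \<le> \<alpha> t * (\<Sum>i=1..N. a i * u x t powr (p i - 1))"
      using assms(5,14) t by (intro mult_nonneg_nonneg sum_nonneg) auto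
    then show "\<gamma> t * ((tangent_norm g x (gradient A g (\<lambda>y. u y t) x))\<^sup>2 / (u x t)\<^sup>2)
        - \<alpha> t * (deriv (\<lambda>s. u x s) t / u x t) - \<phi> t \<le> 0"
      using assms(15)[rule_format, OF x t] by linarith
  qed
  note cont = assms(10-12)[THEN Ck_on_1_continuous]
  show ?thesis
  proof (intro conjI allI impI)
    fix l assume l: "smooth_path X A t\<^sub>1 t\<^sub>2 l \<and> l t\<^sub>1 = x\<^sub>1 \<and> l t\<^sub>2 = x\<^sub>2"
    then show "f x\<^sub>2 t\<^sub>2 - f x\<^sub>1 t\<^sub>1 \<ge> integral {t\<^sub>1..t\<^sub>2} (\<lambda>t. - \<phi> t / \<alpha> t
        - \<alpha> t / (4 * \<gamma> t) * (tangent_norm g (l t) (velocity A t\<^sub>1 t\<^sub>2 l t))\<^sup>2)"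
      using harnack_smooth_path[OF assms(6,7,13,14) cont harnack assms(18,19), of l]
      by (simp add: assms(9))
  next
    fix \<alpha>\<^sub>0 \<gamma>\<^sub>0 assume const: "\<forall>t>0. \<alpha> t = \<alpha>\<^sub>0 \<and> \<gamma> t = \<gamma>\<^sub>0"
    have pos0: "\<gamma>\<^sub>0 > 0" "\<alpha>\<^sub>0 > 0"
      using assms(13,14,18) const by metis+
    have harnack0: "\<forall>x\<in>topspace X. \<forall>t>0.
        \<gamma>\<^sub>0 * ((tangent_norm g x (gradient A g (\<lambda>y. u y t) x))\<^sup>2 / (u x t)\<^sup>2)
          - \<alpha>\<^sub>0 * (deriv (\<lambda>s. u x s) t / u x t) - \<phi> t \<le> 0"
      using harnack const by simp
    let ?d = "riemannian_dist X A g x\<^sub>1 x\<^sub>2" and ?T = "t\<^sub>2 - t\<^sub>1"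
    let ?C = "\<alpha>\<^sub>0 / (4 * \<gamma>\<^sub>0)" and ?I = "integral {t\<^sub>1..t\<^sub>2} (\<lambda>t. \<phi> t / \<alpha>\<^sub>0)"
    \<comment> \<open>The bound for a path of length at most \<open>?d + \<epsilon>\<close> under a
      clock regularized by the same \<epsilon>.\<close>
    let ?b = "\<lambda>\<epsilon>. - ?I - ?C * ((?d + \<epsilon>) * (?d + \<epsilon> + \<epsilon>) / ?T)"
    have bound: "?b \<epsilon> \<le> f x\<^sub>2 t\<^sub>2 - f x\<^sub>1 t\<^sub>1" if \<epsilon>: "\<epsilon> > 0" for \<epsilon>
    proof -
      let ?S = "{curve_length A g 0 1 l | l. piecewise_smooth_path X A 0 1 l \<and> l 0 = x\<^sub>1 \<and> l 1 = x\<^sub>2}"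
      have ne: "?S \<noteq> {}"
        using piecewise_smooth_path_exists[OF conn assms(16,17)] by blast
      have less: "Inf ?S < ?d + \<epsilon>"
        using \<epsilon> by (simp add: riemannian_dist_def)
      obtain L where "L \<in> ?S" and L: "L < ?d + \<epsilon>"
        using cInf_lessD[OF ne less] by (rule bexE)
      then obtain l where l: "L = curve_length A g 0 1 l" "piecewise_smooth_path X A 0 1 l"
        "l 0 = x\<^sub>1" "l 1 = x\<^sub>2" by blast
      note hp = harnack_piecewise_smooth_path[OF assms(6,7) pos0 cont(3) harnack0 assms(18,19)
          l(2) \<epsilon>, folded l(1)]
      \<comment> \<open>Monotonicity of the product uses that the length \<open>L\<close> is
        nonnegative, which is \<open>hp(1)\<close>.\<close>
      have "L * (L + \<epsilon>) \<le> (?d + \<epsilon>) * (?d + \<epsilon> + \<epsilon>)"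
        using hp(1) L \<epsilon> by (intro mult_mono) auto
      then have "?C * (L * (L + \<epsilon>) / ?T) \<le> ?C * ((?d + \<epsilon>) * (?d + \<epsilon> + \<epsilon>) / ?T)"
        using pos0 assms(19) by (intro mult_left_mono divide_right_mono) auto
      then show ?thesis
        using hp(2) by (simp add: assms(9) l(3,4))
    qed
    \<comment> \<open>The bound is known only for positive \<epsilon>, so the value at
      \<open>0\<close> is reached as a limit from the right.\<close>
    have "isCont ?b 0"
      using assms(19) by (intro continuous_intros) auto
    then have "(?b \<longlongrightarrow> ?b 0) (at_right 0)"
      unfolding isCont_def by (rule filterlim_mono[OF _ order_refl at_le]) simp
    then have "?b 0 \<le> f x\<^sub>2 t\<^sub>2 - f x\<^sub>1 t\<^sub>1"
      by (rule tendsto_upperbound[OF _ eventually_mono[OF eventually_at_right_less bound]]) simp_all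
    then show "f x\<^sub>2 t\<^sub>2 - f x\<^sub>1 t\<^sub>1 \<ge> - ?I - ?C * (?d\<^sup>2 / ?T)"
      by (simp add: power2_eq_square)
  qed
qed

end
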